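(* Let $d\ge 1$ be an integer and let $\vec{\mu}=(\mu_0,\dots,\mu_{d-1})$ be a probability distribution. Let $\mathcal{O}_{\vec{\mu}}$ be the generalized platypus channel associated with $\vec{\mu}$. Then the quantum capacity of $\mathcal{O}_{\vec{\mu}}$ satisfies $$Q(\mathcal{O}_{\vec{\mu}})\le \log\Big(1+\sqrt{\max_i \mu_i}\Big).$$
   Context: Logarithms are base 2. Generalized platypus channel: let $A$ and $B$ be $(d+1)$-dimensional Hilbert spaces with computational bases $\{|i\rangle\}_{i=0}^{d}$ and $E$ a $d$-dimensional Hilbert space with basis $\{|j\rangle\}_{j=0}^{d-1}$. Define the isometry $V:A\to B\otimes E$ by $V|0\rangle=\sum_{j=0}^{d-1}\sqrt{\mu_j}\,|j\rangle_B\otimes|j\rangle_E$ and $V|i\rangle=|d\rangle_B\otimes|i-1\rangle_E$ for $i=1,\dots,d$. Then $\mathcal{O}_{\vec{\mu}}(\rho)=\mathrm{Tr}_E(V\rho V^\dagger)$, with complementary channel $\mathcal{O}_{\vec{\mu}}^c(\rho)=\mathrm{Tr}_B(V\rho V^\dagger)$. For a channel $\mathcal{N}$ with Stinespring isometry and complementary channel $\mathcal{N}^c$, the coherent information is $Q^{(1)}(\mathcal{N})=\max_\rho [S(\mathcal{N}(\rho))-S(\mathcal{N}^c(\rho))]$ ($S$ = von Neumann entropy), and the quantum capacity is $Q(\mathcal{N})=\lim_{n\to\infty}\frac1n Q^{(1)}(\mathcal{N}^{\otimes n})$. *)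

theory Defs
  imports "Jordan_Normal_Form.Char_Poly" "Jordan_Normal_Form.Conjugate"
begin

text \<open>Digit k (least significant first) of x in base b; used to identify
  C^(b^n) with the n-fold tensor power of C^b.\<close>
definition dig :: "nat \<Rightarrow> nat \<Rightarrow> nat \<Rightarrow> nat" where
  "dig b x k = (x div b ^ k) mod b"

text \<open>Matrix entry <b|_B <e|_E V |a>_A of the platypus isometry V : A -> B (x) E,
  with A, B of dimension d+1 and E of dimension d.\<close>
definition platypus_V :: "nat \<Rightarrow> (nat \<Rightarrow> real) \<Rightarrow> nat \<Rightarrow> nat \<Rightarrow> nat \<Rightarrow> complex" where
  "platypus_V d mu b e a =
     (if a = 0 then (if b = e \<and> b < d then complex_of_real (sqrt (mu b)) else 0)
      else if a \<le> d \<and> b = d \<and> e = a - 1 then 1 else 0)"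

text \<open>Entries of the n-fold tensor power V^(x)n : A^n -> B^n (x) E^n
  (indices b < (d+1)^n, e < d^n, a < (d+1)^n encoded by digits).\<close>
definition platypus_Vn :: "nat \<Rightarrow> (nat \<Rightarrow> real) \<Rightarrow> nat \<Rightarrow> nat \<Rightarrow> nat \<Rightarrow> nat \<Rightarrow> complex" where
  "platypus_Vn d mu n b e a =
     (\<Prod>k<n. platypus_V d mu (dig (d+1) b k) (dig d e k) (dig (d+1) a k))"

definition platypus_chan :: "nat \<Rightarrow> (nat \<Rightarrow> real) \<Rightarrow> nat \<Rightarrow> complex mat \<Rightarrow> complex mat" where
  "platypus_chan d mu n \<rho> = mat ((d+1)^n) ((d+1)^n) (\<lambda>(b, b').
     \<Sum>e<d^n. \<Sum>a<(d+1)^n. \<Sum>a'<(d+1)^n.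
       platypus_Vn d mu n b e a * \<rho> $$ (a, a') * cnj (platypus_Vn d mu n b' e a'))"

definition platypus_compl :: "nat \<Rightarrow> (nat \<Rightarrow> real) \<Rightarrow> nat \<Rightarrow> complex mat \<Rightarrow> complex mat" where
  "platypus_compl d mu n \<rho> = mat (d^n) (d^n) (\<lambda>(e, e').
     \<Sum>b<(d+1)^n. \<Sum>a<(d+1)^n. \<Sum>a'<(d+1)^n.
       platypus_Vn d mu n b e a * \<rho> $$ (a, a') * cnj (platypus_Vn d mu n b e' a'))"

definition density_op :: "nat \<Rightarrow> complex mat \<Rightarrow> bool" where
  "density_op N \<rho> \<longleftrightarrow> \<rho> \<in> carrier_mat N N
     \<and> (\<forall>i<N. \<forall>j<N. \<rho> $$ (i, j) = cnj (\<rho> $$ (j, i)))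
     \<and> (\<forall>v :: nat \<Rightarrow> complex. 0 \<le> Re (\<Sum>i<N. \<Sum>j<N. cnj (v i) * \<rho> $$ (i, j) * v j))
     \<and> (\<Sum>i<N. \<rho> $$ (i, i)) = 1"

definition vn_entropy :: "complex mat \<Rightarrow> real" where
  "vn_entropy A = - (\<Sum>x\<in>{x. poly (char_poly A) x = 0}.
      real (order x (char_poly A)) *
      (if Re x \<le> 0 then 0 else Re x * log 2 (Re x)))"

definition platypus_Q1 :: "nat \<Rightarrow> (nat \<Rightarrow> real) \<Rightarrow> nat \<Rightarrow> real" where
  "platypus_Q1 d mu n = (SUP \<rho>\<in>{\<rho>. density_op ((d+1)^n) \<rho>}.
      vn_entropy (platypus_chan d mu n \<rho>) - vn_entropy (platypus_compl d mu n \<rho>))"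

definition platypus_Q :: "nat \<Rightarrow> (nat \<Rightarrow> real) \<Rightarrow> real" where
  "platypus_Q d mu = lim (\<lambda>n. platypus_Q1 d mu n / real n)"

end

theory Submission
  imports Defs "Jordan_Normal_Form.Schur_Decomposition"
begin

text \<open>
  Let \<open>J\<close> be the Choi matrix of the channel and \<open>t = sqrt (max mu)\<close>. Its partial transpose is
  \<open>\<Sum>s. \<epsilon> s |f s\<rangle>\<langle>f s|\<close> with signs \<open>\<epsilon> s = \<plusminus>1\<close>, where the marginal of \<open>\<Sum>s. |f s\<rangle>\<langle>f s|\<close> on the input is
  at most \<open>1 + t\<close>; this passes to tensor powers by multiplying the vectors. If the marginal \<open>\<sigma>\<close> of a
  purification on reference and output has such a signed partial transpose, then \<open>\<sigma> \<le> 1 \<otimes> \<omega>\<close>,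
  where \<open>\<omega>\<close> is the transposed output marginal of the unsigned sum: for
  \<open>G s l l' = \<Sum>b. F s l b * x l' b\<close> this is just \<open>|G s l l' * G s l' l| \<le> (|G s l l'|\<^sup>2 + |G s l' l|\<^sup>2) / 2\<close>.
  Domination of this kind bounds the coherent information by \<open>log (Tr \<omega>)\<close>, which is at most
  \<open>n * log (1 + t)\<close> for \<open>n\<close> uses. Since \<open>lim\<close> is only meaningful for a convergent sequence,
  superadditivity and Fekete's argument are needed as well.
\<close>

subsection \<open>Spectral decomposition of Hermitian matrices and the von Neumann entropy\<close>

text \<open>Why domination is enough: for a pure state on reference, output and environment with
  reference-output marginal sigma, the difference S(output) - S(environment) is the minimum over
  output states rho of the relative entropy D(sigma || 1 x rho). Taking rho = omega / Tr omega
  leaves at most log (Tr omega) as soon as sigma is dominated by 1 x omega. Where 1 + t comes from: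
  the off-diagonal part |w><v| + |v><w| of the partial transpose, v = |0,d>, is unchanged when v is
  scaled by sqrt t and w by 1 / sqrt t. The scaling only shifts weight in the unsigned marginal,
  which becomes 1 + t on input 0 and 1 + mu (i - 1) / t on input i. The larger of t and max mu / t
  is smallest when t squared is max mu. The signed decomposition need not be spectral. Only signs of
  modulus at most one and the unsigned marginal enter, and both are multiplicative over copies, so
  regularization costs nothing.\<close>

definition tr :: "complex mat \<Rightarrow> complex" where
  "tr A = (\<Sum>i<dim_row A. A $$ (i, i))"

lemma tr_mult_commute:
  assumes "A \<in> carrier_mat n n" "B \<in> carrier_mat n n"
  shows "tr (A * B) = tr (B * A)"
proof -
  have "tr (A * B) = (\<Sum>i<n. \<Sum>j<n. A $$ (i, j) * B $$ (j, i))"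
    using assms by (auto simp: tr_def scalar_prod_def atLeast0LessThan intro!: sum.cong)
  also have "\<dots> = (\<Sum>j<n. \<Sum>i<n. B $$ (j, i) * A $$ (i, j))"
    by (subst sum.swap) (simp add: mult.commute)
  also have "\<dots> = tr (B * A)"
    using assms by (auto simp: tr_def scalar_prod_def atLeast0LessThan intro!: sum.cong)
  finally show ?thesis .
qed

text \<open>If every eigenvalue were 0, the Schur form would be strictly upper triangular and the
  trace of \<open>B * B\<close> would vanish. For Hermitian \<open>B\<close> this trace is the sum
  of the squared moduli of all entries.\<close>

lemma hermitian_nonzero_eigenvalue:
  fixes B :: "complex mat"
  assumes B: "B \<in> carrier_mat n n"
    and herm: "\<And>i j. i < n \<Longrightarrow> j < n \<Longrightarrow> B $$ (i, j) = cnj (B $$ (j, i))"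
    and nz: "B \<noteq> 0\<^sub>m n n"
  shows "\<exists>k. k \<noteq> 0 \<and> eigenvalue B k"
proof (rule ccontr)
  assume no: "\<not> ?thesis"
  obtain as where as: "char_poly B = (\<Prod>a\<leftarrow>as. [:- a, 1:])"
    using char_poly_factorized[OF B] by blast
  have as0: "a = 0" if "a \<in> set as" for a
  proof -
    have "poly (char_poly B) a = 0"
      using that by (simp add: as poly_prod_list prod_list_zero_iff image_iff)
    then show ?thesis
      using no eigenvalue_root_char_poly[OF B] by blast
  qed
  obtain T P Q where TPQ: "schur_decomposition B as = (T, P, Q)"
    by (cases "schur_decomposition B as") auto
  from schur_decomposition[OF B as TPQ]
  have wit: "similar_mat_wit B T P Q" and ut: "upper_triangular T" and diag: "diag_mat T = as"
    by auto
  from similar_mat_witD2[OF B wit]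
  have PQ: "P * Q = 1\<^sub>m n" "Q * P = 1\<^sub>m n" "B = P * T * Q"
    and c: "T \<in> carrier_mat n n" "P \<in> carrier_mat n n" "Q \<in> carrier_mat n n" by auto
  have Tii: "T $$ (i, i) = 0" if "i < n" for i
    using as0[of "T $$ (i,i)"] that c by (auto simp: diag[symmetric] diag_mat_def)
  \<comment> \<open>Off the diagonal, one of the two factors lies strictly below it.\<close>
  have "T $$ (i, k) * T $$ (k, i) = 0" if "i < n" "k < n" for i k
    using Tii that upper_triangularD[OF ut, of i k] upper_triangularD[OF ut, of k i] c
    by (cases i k rule: linorder_cases) auto
  then have TT: "tr (T * T) = 0"
    using c by (auto simp: tr_def scalar_prod_def intro!: sum.neutral)
  have "B * B = P * (T * T * Q)"
  proof -
    have "B * B = P * (T * (Q * P) * (T * Q))"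
      unfolding PQ(3) using c by (simp add: assoc_mult_mat[of _ n n _ n _ n])
    then show ?thesis using c by (simp add: PQ(2) assoc_mult_mat[of _ n n _ n _ n])
  qed
  then have "tr (B * B) = tr ((T * T * Q) * P)"
    using tr_mult_commute[of P n "T * T * Q"] c by simp
  also have "(T * T * Q) * P = T * T"
    using c by (simp add: PQ(2) assoc_mult_mat[of _ n n _ n _ n])
  finally have "tr (B * B) = 0" using TT by simp
  moreover have "tr (B * B) = (\<Sum>i<n. \<Sum>j<n. complex_of_real ((cmod (B $$ (i, j)))\<^sup>2))"
  proof -
    have "tr (B * B) = (\<Sum>i<n. \<Sum>j<n. B $$ (i, j) * B $$ (j, i))"
      using B by (auto simp: tr_def scalar_prod_def atLeast0LessThan intro!: sum.cong)
    also have "\<dots> = (\<Sum>i<n. \<Sum>j<n. complex_of_real ((cmod (B $$ (i, j)))\<^sup>2))"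
    proof (intro sum.cong refl)
      fix i j assume "i \<in> {..<n}" "j \<in> {..<n}"
      then have "B $$ (j, i) = cnj (B $$ (i, j))" using herm[of j i] by simp
      then show "B $$ (i, j) * B $$ (j, i) = complex_of_real ((cmod (B $$ (i, j)))\<^sup>2)"
        by (simp only: complex_norm_square)
    qed
    finally show ?thesis .
  qed
  ultimately have "complex_of_real (\<Sum>i<n. \<Sum>j<n. (cmod (B $$ (i, j)))\<^sup>2) = 0" by simp
  then have "(\<Sum>i<n. \<Sum>j<n. (cmod (B $$ (i, j)))\<^sup>2) = 0" by (simp only: of_real_eq_0_iff)
  then have "\<forall>i<n. \<forall>j<n. B $$ (i, j) = 0"
    by (auto simp: sum_nonneg_eq_0_iff sum_nonneg)
  then have "B = 0\<^sub>m n n" using B by (intro eq_matI) auto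
  then show False using nz by simp
qed

definition onb :: "nat \<Rightarrow> (nat \<Rightarrow> nat \<Rightarrow> complex) \<Rightarrow> bool" where
  "onb N u \<longleftrightarrow> (\<forall>k<N. \<forall>l<N. (\<Sum>i<N. u k i * cnj (u l i)) = of_bool (k = l))"

text \<open>Resolution of the identity: \<open>N\<close> orthonormal vectors in dimension
  \<open>N\<close> give a one-sided inverse of a square matrix, which is two-sided.\<close>

lemma onb_complete:
  assumes "onb N u" "i < N" "j < N"
  shows "(\<Sum>k<N. u k i * cnj (u k j)) = of_bool (i = j)"
proof -
  let ?A = "mat N N (\<lambda>(k, i). u k i)" and ?B = "mat N N (\<lambda>(i, k). cnj (u k i))"
  have "?A * ?B = 1\<^sub>m N"
    using assms(1) by (intro eq_matI) (auto simp: onb_def scalar_prod_def atLeast0LessThan)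
  then have "?B * ?A = 1\<^sub>m N"
    by (intro mat_mult_left_right_inverse[of ?A N ?B]) auto
  then have "(?B * ?A) $$ (j, i) = of_bool (i = j)" using assms by auto
  then show ?thesis
    using assms by (simp add: scalar_prod_def atLeast0LessThan mult.commute)
qed

definition eigsys :: "nat \<Rightarrow> (nat \<Rightarrow> nat \<Rightarrow> complex) \<Rightarrow> (nat \<Rightarrow> nat \<Rightarrow> complex) \<Rightarrow> (nat \<Rightarrow> real) \<Rightarrow> bool"
  where "eigsys N A u lam \<longleftrightarrow> onb N u \<and>
    (\<forall>k<N. \<forall>i<N. (\<Sum>j<N. A i j * u k j) = complex_of_real (lam k) * u k i)"

lemma eigsys_quadratic:
  assumes "eigsys N A u lam" "k < N"
  shows "(\<Sum>i<N. \<Sum>j<N. cnj (u k i) * A i j * u k j) = complex_of_real (lam k)"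
proof -
  have "(\<Sum>i<N. \<Sum>j<N. cnj (u k i) * A i j * u k j)
      = (\<Sum>i<N. cnj (u k i) * (\<Sum>j<N. A i j * u k j))"
    by (simp add: sum_distrib_left mult.assoc)
  also have "\<dots> = (\<Sum>i<N. cnj (u k i) * (complex_of_real (lam k) * u k i))"
    using assms by (intro sum.cong) (auto simp: eigsys_def)
  also have "\<dots> = complex_of_real (lam k) * (\<Sum>i<N. u k i * cnj (u k i))"
    by (simp add: sum_distrib_left mult_ac)
  also have "\<dots> = complex_of_real (lam k)"
    using assms by (auto simp: eigsys_def onb_def)
  finally show ?thesis .
qed

lemma eigsys_expand:
  assumes "eigsys N A u lam" "i < N" "j < N"
  shows "A i j = (\<Sum>k<N. complex_of_real (lam k) * u k i * cnj (u k j))"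
proof -
  have onb: "onb N u" using assms by (simp add: eigsys_def)
  have "(\<Sum>k<N. complex_of_real (lam k) * u k i * cnj (u k j))
      = (\<Sum>k<N. (\<Sum>l<N. A i l * u k l) * cnj (u k j))"
    using assms by (intro sum.cong) (auto simp: eigsys_def)
  also have "\<dots> = (\<Sum>l<N. A i l * (\<Sum>k<N. u k l * cnj (u k j)))"
    unfolding sum_distrib_left sum_distrib_right by (subst sum.swap) (simp add: mult.assoc)
  also have "\<dots> = (\<Sum>l<N. A i l * of_bool (l = j))"
    using assms onb by (intro sum.cong) (auto simp: onb_complete)
  also have "\<dots> = A i j" using assms by (simp add: of_bool_def if_distrib cong: if_cong)
  finally show ?thesis by simp
qed

lemma eigsys_trace:
  assumes "eigsys N A u lam"
  shows "(\<Sum>i<N. A i i) = complex_of_real (\<Sum>k<N. lam k)"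
proof -
  have onb: "onb N u" using assms by (simp add: eigsys_def)
  have "(\<Sum>i<N. A i i) = (\<Sum>i<N. \<Sum>k<N. complex_of_real (lam k) * u k i * cnj (u k i))"
    using assms by (intro sum.cong) (auto simp: eigsys_expand)
  also have "\<dots> = (\<Sum>k<N. complex_of_real (lam k) * (\<Sum>i<N. u k i * cnj (u k i)))"
    by (subst sum.swap) (simp add: sum_distrib_left mult.assoc)
  also have "\<dots> = (\<Sum>k<N. complex_of_real (lam k))"
    using onb by (intro sum.cong) (auto simp: onb_def)
  finally show ?thesis by simp
qed

definition eta :: "real \<Rightarrow> real" where
  "eta x = (if x \<le> 0 then 0 else x * log 2 x)"

lemma sum_count_mset:
  fixes f :: "'a \<Rightarrow> real"
  shows "(\<Sum>x\<in>set_mset M. real (count M x) * f x) = (\<Sum>x\<in>#M. f x)"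
proof (induction M)
  case (add a M)
  have "(\<Sum>x\<in>set_mset (add_mset a M). real (count (add_mset a M) x) * f x)
      = (\<Sum>x\<in>insert a (set_mset M). real (count M x) * f x + (if x = a then f x else 0))"
    by (intro sum.cong) (auto simp: algebra_simps)
  also have "\<dots> = (\<Sum>x\<in>insert a (set_mset M). real (count M x) * f x) + f a"
    by (simp add: sum.distrib)
  also have "(\<Sum>x\<in>insert a (set_mset M). real (count M x) * f x)
      = (\<Sum>x\<in>set_mset M. real (count M x) * f x)"
    by (intro sum.mono_neutral_right) (auto simp: not_in_iff)
  finally show ?case using add by simp
qed simp

text \<open>\<open>vn_entropy\<close> runs over distinct roots weighted by \<open>order\<close>.
  Diagonalization splits the characteristic polynomial over the \<open>lam k\<close>, and the
  multiset \<open>proots\<close> converts the weighted sum into one over the index \<open>k\<close>,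
  where repeated eigenvalues simply repeat.\<close>

lemma vn_entropy_eigsys:
  assumes "eigsys N A u lam"
  shows "vn_entropy (mat N N (\<lambda>(i, j). A i j)) = - (\<Sum>k<N. eta (lam k))"
proof -
  have onb: "onb N u" using assms by (simp add: eigsys_def)
  let ?A = "mat N N (\<lambda>(i, j). A i j)"
  let ?U = "mat N N (\<lambda>(i, k). u k i)" and ?V = "mat N N (\<lambda>(k, i). cnj (u k i))"
  let ?D = "mat N N (\<lambda>(k, l). if k = l then complex_of_real (lam k) else 0)"
  have UV: "?U * ?V = 1\<^sub>m N"
    using onb by (intro eq_matI) (auto simp: scalar_prod_def atLeast0LessThan onb_complete)
  have VU: "?V * ?U = 1\<^sub>m N"
    by (rule mat_mult_left_right_inverse[OF _ _ UV]) auto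
  have UD: "?U * ?D = mat N N (\<lambda>(i, k). complex_of_real (lam k) * u k i)"
    by (intro eq_matI)
      (auto simp: scalar_prod_def atLeast0LessThan if_distrib mult.commute cong: if_cong)
  have "?A = ?U * ?D * ?V"
    unfolding UD using assms
    by (intro eq_matI) (auto simp: scalar_prod_def atLeast0LessThan eigsys_expand)
  then have "similar_mat ?A ?D"
    by (intro similar_matI[of _ _ ?U ?V N] UV VU) auto
  then have "char_poly ?A = char_poly ?D" by (rule char_poly_similar)
  also have "\<dots> = (\<Prod>a\<leftarrow>diag_mat ?D. [:- a, 1:])"
    by (rule char_poly_upper_triangular[of _ N]) auto
  also have "diag_mat ?D = map (\<lambda>k. complex_of_real (lam k)) [0..<N]"
    by (auto simp: diag_mat_def)
  finally have cp: "char_poly ?A = (\<Prod>k\<leftarrow>[0..<N]. [:- complex_of_real (lam k), 1:])"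
    by (simp add: o_def)
  also have "\<dots> = (\<Prod>k<N. [:- complex_of_real (lam k), 1:])"
    by (simp add: prod.distinct_set_conv_list[symmetric] atLeast0LessThan)
  finally have cp: "char_poly ?A = (\<Prod>k<N. [:- complex_of_real (lam k), 1:])" .
  have nz: "char_poly ?A \<noteq> 0" by (simp add: cp)
  have pr: "proots (char_poly ?A) = (\<Sum>k<N. {#complex_of_real (lam k)#})"
    unfolding cp by (subst proots_prod) auto
  have "vn_entropy ?A = - (\<Sum>x\<in>set_mset (proots (char_poly ?A)).
          real (count (proots (char_poly ?A)) x) * eta (Re x))"
    unfolding vn_entropy_def eta_def set_count_proots[OF nz] count_proots[OF nz] ..
  also have "(\<Sum>x\<in>set_mset M. real (count M x) * eta (Re x)) = (\<Sum>x\<in>#M. eta (Re x))" for M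
    by (rule sum_count_mset)
  also have "(\<Sum>x\<in>#proots (char_poly ?A). eta (Re x)) = (\<Sum>k<N. eta (lam k))"
  proof -
    have "(\<Sum>x\<in>#(\<Sum>k<n. {#complex_of_real (lam k)#}). eta (Re x)) = (\<Sum>k<n. eta (lam k))" for n
      by (induction n) auto
    then show ?thesis by (simp add: pr)
  qed
  finally show ?thesis .
qed

text \<open>Induction on the number of eigenvectors found. A Hermitian \<open>A\<close> preserves
  the orthogonal complement of those already found, so the next one is sought for the compression of
  \<open>A\<close> to that complement. The compression also annihilates the old eigenvectors, so an
  eigenvector of it is known to lie in the complement only if its eigenvalue is nonzero; a vanishing
  compression is treated separately.\<close>

lemma hermitian_partial_onb:
  fixes A :: "nat \<Rightarrow> nat \<Rightarrow> complex"
  assumes herm: "\<And>i j. i < N \<Longrightarrow> j < N \<Longrightarrow> A i j = cnj (A j i)"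
  shows "m \<le> (N::nat) \<Longrightarrow> \<exists>(u::nat \<Rightarrow> nat \<Rightarrow> complex) lam. (\<forall>k<m. \<forall>l<m. (\<Sum>i<N. u k i * cnj (u l i)) = of_bool (k = l)) \<and>
    (\<forall>k<m. \<forall>i<N. (\<Sum>j<N. A i j * u k j) = complex_of_real (lam k) * u k i)"
proof (induction m)
  case (Suc m)
  then have "m \<le> N" by simp
  from Suc.IH[OF this] obtain u lam where
    on: "\<And>k l. k < m \<Longrightarrow> l < m \<Longrightarrow> (\<Sum>i<N. u k i * cnj (u l i)) = of_bool (k = l)" and
    ev: "\<And>k i. k < m \<Longrightarrow> i < N \<Longrightarrow> (\<Sum>j<N. A i j * u k j) = complex_of_real (lam k) * u k i"
    by blast
  have m: "m < N" using Suc by simp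
  have hermc: "cnj (A i j) = A j i" if "i < N" "j < N" for i j
    using herm[of j i] that by simp
  define pr where "pr x i = x i - (\<Sum>k<m. (\<Sum>j<N. cnj (u k j) * x j) * u k i)" for x :: "nat \<Rightarrow> complex" and i
  define perp where "perp x \<longleftrightarrow> (\<forall>k<m. (\<Sum>j<N. cnj (u k j) * x j) = 0)" for x :: "nat \<Rightarrow> complex"
  have pr_perp: "perp (pr x)" for x
    unfolding perp_def
  proof (intro allI impI)
    fix l assume l: "l < m"
    have "(\<Sum>i<N. cnj (u l i) * pr x i) = (\<Sum>i<N. cnj (u l i) * x i)
        - (\<Sum>i<N. \<Sum>k<m. (\<Sum>j<N. cnj (u k j) * x j) * (u k i * cnj (u l i)))"
      unfolding pr_def by (simp add: algebra_simps sum_subtractf sum_distrib_left)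
    also have "(\<Sum>i<N. \<Sum>k<m. (\<Sum>j<N. cnj (u k j) * x j) * (u k i * cnj (u l i)))
        = (\<Sum>k<m. (\<Sum>j<N. cnj (u k j) * x j) * (\<Sum>i<N. u k i * cnj (u l i)))"
      by (subst sum.swap) (simp add: sum_distrib_left)
    also have "\<dots> = (\<Sum>k<m. (\<Sum>j<N. cnj (u k j) * x j) * of_bool (k = l))"
      using l on by (intro sum.cong) auto
    also have "\<dots> = (\<Sum>j<N. cnj (u l j) * x j)"
      using l by (simp add: of_bool_def if_distrib cong: if_cong)
    finally show "(\<Sum>i<N. cnj (u l i) * pr x i) = 0" by simp
  qed
  have pr_id: "pr x i = x i" if "perp x" for x i
    using that by (auto simp: pr_def perp_def)
  have A_perp: "perp (\<lambda>i. \<Sum>j<N. A i j * x j)" if x: "perp x" for x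
    unfolding perp_def
  proof (intro allI impI)
    fix k assume k: "k < m"
    have "(\<Sum>i<N. cnj (u k i) * (\<Sum>j<N. A i j * x j)) = (\<Sum>j<N. (\<Sum>i<N. cnj (A j i * u k i)) * x j)"
      unfolding sum_distrib_left sum_distrib_right
      by (subst sum.swap) (auto intro!: sum.cong simp: hermc)
    also have "\<dots> = (\<Sum>j<N. complex_of_real (lam k) * (cnj (u k j) * x j))"
    proof (intro sum.cong refl)
      fix j assume "j \<in> {..<N}"
      then have "(\<Sum>i<N. cnj (A j i * u k i)) = complex_of_real (lam k) * cnj (u k j)"
        using arg_cong[OF ev[OF k, of j], of cnj] by simp
      then show "(\<Sum>i<N. cnj (A j i * u k i)) * x j = complex_of_real (lam k) * (cnj (u k j) * x j)"
        by simp
    qed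
    also have "\<dots> = 0" using x k by (simp add: sum_distrib_left[symmetric] perp_def)
    finally show "(\<Sum>i<N. cnj (u k i) * (\<Sum>j<N. A i j * x j)) = 0" .
  qed
  obtain v \<mu> where v: "perp v" "\<exists>i<N. v i \<noteq> 0" and v_ev: "\<And>i. i < N \<Longrightarrow> (\<Sum>j<N. A i j * v j) = \<mu> * v i"
  proof -
    \<comment> \<open>The matrix of the projection \<open>pr\<close>; the compression below is
      \<open>B = K A K\<close>.\<close>
    define K where "K i j = of_bool (i = j) - (\<Sum>k<m. u k i * cnj (u k j))" for i j
    have K_cnj: "cnj (K i j) = K j i" for i j
      by (auto simp: K_def mult.commute)
    have pr_K: "pr x i = (\<Sum>j<N. K i j * x j)" if "i < N" for x i
    proof -
      have "(\<Sum>j<N. K i j * x j) = (\<Sum>j<N. of_bool (i = j) * x j) - (\<Sum>j<N. \<Sum>k<m. u k i * cnj (u k j) * x j)"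
        by (simp add: K_def algebra_simps sum_subtractf sum_distrib_left)
      also have "(\<Sum>j<N. of_bool (i = j) * x j) = x i"
        using that by (subst sum.remove[of _ i]) auto
      also have "(\<Sum>j<N. \<Sum>k<m. u k i * cnj (u k j) * x j) = (\<Sum>k<m. (\<Sum>j<N. cnj (u k j) * x j) * u k i)"
        by (subst sum.swap) (simp add: sum_distrib_left mult_ac)
      finally show ?thesis by (simp add: pr_def)
    qed
    define B where "B = mat N N (\<lambda>(i, j). \<Sum>a<N. \<Sum>b<N. K i a * A a b * K b j)"
    have B: "B \<in> carrier_mat N N" by (simp add: B_def)
    have B_mult: "(\<Sum>j<N. B $$ (i, j) * x j) = pr (\<lambda>a. \<Sum>b<N. A a b * pr x b) i" if "i < N" for i x
    proof -
      have "(\<Sum>j<N. B $$ (i, j) * x j) = (\<Sum>j<N. \<Sum>a<N. \<Sum>b<N. K i a * A a b * (K b j * x j))"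
        using that by (simp add: B_def sum_distrib_right mult.assoc)
      also have "\<dots> = (\<Sum>a<N. \<Sum>b<N. \<Sum>j<N. K i a * A a b * (K b j * x j))"
        by (subst sum.swap, rule sum.cong[OF refl], rule sum.swap)
      also have "\<dots> = (\<Sum>a<N. K i a * (\<Sum>b<N. A a b * (\<Sum>j<N. K b j * x j)))"
        by (simp add: sum_distrib_left mult.assoc)
      also have "\<dots> = pr (\<lambda>a. \<Sum>b<N. A a b * pr x b) i"
        using that by (simp add: pr_K)
      finally show ?thesis .
    qed
    have B_perp: "(\<Sum>j<N. B $$ (i, j) * x j) = (\<Sum>j<N. A i j * x j)" if "i < N" "perp x" for i x
      using that by (simp add: B_mult pr_id A_perp)
    have B_herm: "B $$ (i, j) = cnj (B $$ (j, i))" if "i < N" "j < N" for i j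
    proof -
      have "cnj (B $$ (j, i)) = (\<Sum>a<N. \<Sum>b<N. K a j * A b a * K i b)"
        using that by (auto simp: B_def K_cnj hermc intro!: sum.cong)
      also have "\<dots> = B $$ (i, j)"
        using that by (subst sum.swap) (simp add: B_def mult_ac)
      finally show ?thesis by simp
    qed
    show ?thesis
    proof (cases "B = 0\<^sub>m N N")
      case True
      \<comment> \<open>The projection has trace \<open>N - m\<close>, which is not 0, so some
        column of \<open>K\<close> is nonzero. When the compression vanishes, that column is an
        eigenvector of \<open>A\<close> for the eigenvalue 0.\<close>
      have "(\<Sum>j<N. K j j) = of_nat N - (\<Sum>k<m. \<Sum>j<N. u k j * cnj (u k j))"
        by (subst sum.swap) (simp add: K_def sum_subtractf)
      also have "\<dots> = of_nat N - of_nat m"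
        by (simp add: on)
      also have "\<dots> \<noteq> 0" using m by simp
      finally have "(\<Sum>j<N. K j j) \<noteq> 0" .
      then obtain j where j: "j < N" "K j j \<noteq> 0"
        by (meson lessThan_iff sum.not_neutral_contains_not_neutral)
      define v where "v = pr (\<lambda>i. of_bool (i = j))"
      have v_perp: "perp v" by (simp add: v_def pr_perp)
      have "v i = K i j" if "i < N" for i
        using that j by (simp add: v_def pr_K of_bool_def if_distrib cong: if_cong)
      then have "\<exists>i<N. v i \<noteq> 0" using j by auto
      moreover have "(\<Sum>j<N. A i j * v j) = 0 * v i" if "i < N" for i
        using B_perp[OF that v_perp] True that by simp
      ultimately show ?thesis using that v_perp by blast
    next
      case False
      obtain k where k: "k \<noteq> 0" "eigenvalue B k"
        using hermitian_nonzero_eigenvalue[OF B B_herm False] by blast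
      then obtain z where z: "z \<in> carrier_vec N" "z \<noteq> 0\<^sub>v N" "B *\<^sub>v z = k \<cdot>\<^sub>v z"
        using B by (auto simp: eigenvalue_def eigenvector_def)
      have Bz: "(\<Sum>j<N. B $$ (i, j) * z $ j) = k * z $ i" if "i < N" for i
        using arg_cong[OF z(3), of "\<lambda>w. w $ i"] that z(1) B
        by (simp add: scalar_prod_def atLeast0LessThan)
      \<comment> \<open>Division by the nonzero \<open>k\<close> exhibits \<open>z\<close> as
        \<open>B\<close> applied to \<open>x\<close>, hence as a value of \<open>pr\<close>, so it
        lies in the complement.\<close>
      define x where "x = (\<lambda>i. z $ i / k)"
      define v where "v = pr (\<lambda>a. \<Sum>b<N. A a b * pr x b)"
      have v_perp: "perp v" by (simp add: v_def pr_perp)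
      have vz: "v i = z $ i" if "i < N" for i
        using Bz[OF that] k(1)
        by (simp add: v_def B_mult[OF that, symmetric] x_def sum_divide_distrib[symmetric])
      have "\<exists>i<N. v i \<noteq> 0"
        using z(1,2) vz by (metis carrier_vecD eq_vecI index_zero_vec)
      moreover have "(\<Sum>j<N. A i j * v j) = k * v i" if "i < N" for i
        using B_perp[OF that v_perp] Bz[OF that] that by (simp add: vz)
      ultimately show ?thesis using that v_perp by blast
    qed
  qed
  define nv where "nv = (\<Sum>i<N. (cmod (v i))\<^sup>2)"
  have nv: "nv > 0"
    using v(2) unfolding nv_def by (auto intro!: sum_pos2)
  have nv_eq: "(\<Sum>i<N. v i * cnj (v i)) = complex_of_real nv"
    by (simp add: nv_def complex_norm_square[symmetric])
  have "\<mu> * complex_of_real nv = cnj \<mu> * complex_of_real nv"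
  proof -
    have "\<mu> * complex_of_real nv = (\<Sum>i<N. (\<Sum>j<N. A i j * v j) * cnj (v i))"
      unfolding nv_eq[symmetric] by (simp add: v_ev sum_distrib_left mult.assoc)
    also have "\<dots> = (\<Sum>j<N. v j * cnj (\<Sum>i<N. A j i * v i))"
      unfolding cnj_sum sum_distrib_left sum_distrib_right
      by (subst sum.swap) (auto intro!: sum.cong simp: hermc mult_ac)
    also have "\<dots> = (\<Sum>j<N. v j * cnj (\<mu> * v j))"
      by (rule sum.cong) (simp_all only: v_ev lessThan_iff)
    also have "\<dots> = cnj \<mu> * complex_of_real nv"
      unfolding nv_eq[symmetric] by (simp add: v_ev sum_distrib_left mult_ac)
    finally show ?thesis .
  qed
  then have "\<mu> = cnj \<mu>" using nv by simp
  then obtain r where r: "\<mu> = complex_of_real r" 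
    by (metis Reals_cnj_iff Reals_cases)
  define w where "w i = v i / complex_of_real (sqrt nv)" for i
  have w1: "(\<Sum>i<N. w i * cnj (w i)) = 1"
  proof -
    have "complex_of_real (sqrt nv) * complex_of_real (sqrt nv) = complex_of_real nv"
      using nv by (simp flip: of_real_mult)
    then have "(\<Sum>i<N. w i * cnj (w i)) = (\<Sum>i<N. v i * cnj (v i)) / complex_of_real nv"
      by (simp add: w_def sum_divide_distrib)
    then show ?thesis using nv by (simp add: nv_eq)
  qed
  have w2: "(\<Sum>i<N. w i * cnj (u k i)) = 0" if "k < m" for k
  proof -
    have "(\<Sum>i<N. w i * cnj (u k i)) = (\<Sum>i<N. cnj (u k i) * v i) / complex_of_real (sqrt nv)"
      by (simp add: w_def sum_divide_distrib mult.commute)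
    then show ?thesis using v(1) that by (simp add: perp_def)
  qed
  have w3: "(\<Sum>i<N. u k i * cnj (w i)) = 0" if "k < m" for k
    using arg_cong[OF w2[OF that], of cnj] by (simp add: mult.commute)
  have w4: "(\<Sum>j<N. A i j * w j) = complex_of_real r * w i" if "i < N" for i
    using v_ev[OF that] by (simp add: w_def r sum_divide_distrib[symmetric])
  show ?case
    by (rule exI[of _ "u(m := w)"], rule exI[of _ "lam(m := r)"])
      (auto simp: less_Suc_eq on ev w1 w2 w3 w4)
qed auto

lemma spectral_hermitian:
  fixes A :: "nat \<Rightarrow> nat \<Rightarrow> complex"
  assumes "\<And>i j. i < N \<Longrightarrow> j < N \<Longrightarrow> A i j = cnj (A j i)"
  obtains u lam where "eigsys N A u lam"
proof -
  have "\<exists>u lam. eigsys N A u lam"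
    unfolding eigsys_def onb_def
    by (rule hermitian_partial_onb[where A = A and N = N and m = N, OF _ order_refl]) (rule assms)
  then show ?thesis using that by blast
qed

subsection \<open>The min-entropy bound on the coherent information\<close>

lemma parseval:
  assumes "onb N u"
  shows "(\<Sum>k<N. (cmod (\<Sum>i<N. cnj (u k i) * x i))\<^sup>2) = (\<Sum>i<N. (cmod (x i))\<^sup>2)"
proof -
  have "complex_of_real (\<Sum>k<N. (cmod (\<Sum>i<N. cnj (u k i) * x i))\<^sup>2)
      = (\<Sum>k<N. \<Sum>i<N. \<Sum>j<N. x i * cnj (x j) * (u k j * cnj (u k i)))"
    by (simp add: complex_norm_square sum_product mult_ac del: of_real_power)
  also have "\<dots> = (\<Sum>i<N. \<Sum>k<N. \<Sum>j<N. x i * cnj (x j) * (u k j * cnj (u k i)))"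
    by (rule sum.swap)
  also have "\<dots> = (\<Sum>i<N. \<Sum>j<N. x i * cnj (x j) * (\<Sum>k<N. u k j * cnj (u k i)))"
    unfolding sum_distrib_left by (rule sum.cong[OF refl], rule sum.swap)
  also have "\<dots> = (\<Sum>i<N. \<Sum>j<N. if j = i then x i * cnj (x j) else 0)"
    using assms by (intro sum.cong) (auto simp: onb_complete)
  also have "\<dots> = complex_of_real (\<Sum>i<N. (cmod (x i))\<^sup>2)"
    by (simp add: complex_norm_square del: of_real_power)
  finally show ?thesis by (simp only: of_real_eq_iff)
qed

text \<open>The source of every positivity statement below. The summation index is a pair because
  tracing out two subsystems produces Gram matrices with two hidden indices.\<close>

lemma gram_quadratic:
  fixes G :: "nat \<Rightarrow> nat \<Rightarrow> nat \<Rightarrow> complex"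
  shows "(\<Sum>i<N. \<Sum>j<N. cnj (x i) * (\<Sum>p<P. \<Sum>q<Q. G p q i * cnj (G p q j)) * x j)
    = complex_of_real (\<Sum>p<P. \<Sum>q<Q. (cmod (\<Sum>i<N. cnj (x i) * G p q i))\<^sup>2)"
proof -
  have "(\<Sum>i<N. \<Sum>j<N. cnj (x i) * (\<Sum>p<P. \<Sum>q<Q. G p q i * cnj (G p q j)) * x j)
      = (\<Sum>i<N. \<Sum>j<N. \<Sum>p<P. \<Sum>q<Q. (cnj (x i) * G p q i) * cnj (cnj (x j) * G p q j))"
    by (simp add: sum_distrib_left sum_distrib_right mult_ac)
  also have "\<dots> = (\<Sum>i<N. \<Sum>p<P. \<Sum>q<Q. \<Sum>j<N. (cnj (x i) * G p q i) * cnj (cnj (x j) * G p q j))"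
    by (subst sum.swap[of _ "{..<P}"], rule sum.cong[OF refl], rule sum.cong[OF refl], rule sum.swap)
  also have "\<dots> = (\<Sum>p<P. \<Sum>q<Q. \<Sum>i<N. \<Sum>j<N. (cnj (x i) * G p q i) * cnj (cnj (x j) * G p q j))"
    by (subst sum.swap, rule sum.cong[OF refl], rule sum.swap)
  also have "\<dots> = complex_of_real (\<Sum>p<P. \<Sum>q<Q. (cmod (\<Sum>i<N. cnj (x i) * G p q i))\<^sup>2)"
    by (simp add: complex_norm_square sum_product del: of_real_power complex_cnj_mult)
  finally show ?thesis .
qed

lemma eigsys_quadratic_form:
  assumes "eigsys N A u lam"
  shows "(\<Sum>i<N. \<Sum>j<N. cnj (x i) * A i j * x j)
    = complex_of_real (\<Sum>k<N. lam k * (cmod (\<Sum>i<N. cnj (u k i) * x i))\<^sup>2)"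
proof -
  have "(\<Sum>i<N. \<Sum>j<N. cnj (x i) * A i j * x j)
      = (\<Sum>i<N. \<Sum>j<N. cnj (x i) * (\<Sum>k<N. complex_of_real (lam k) * u k i * cnj (u k j)) * x j)"
    using assms by (intro sum.cong) (auto simp: eigsys_expand)
  also have "\<dots> = (\<Sum>i<N. \<Sum>j<N. \<Sum>k<N. complex_of_real (lam k) * ((cnj (u k j) * x j) * cnj (cnj (u k i) * x i)))"
    by (simp add: sum_distrib_left sum_distrib_right mult_ac)
  also have "\<dots> = (\<Sum>i<N. \<Sum>k<N. \<Sum>j<N. complex_of_real (lam k) * ((cnj (u k j) * x j) * cnj (cnj (u k i) * x i)))"
    by (rule sum.cong[OF refl], rule sum.swap)
  also have "\<dots> = (\<Sum>k<N. \<Sum>i<N. \<Sum>j<N. complex_of_real (lam k) * ((cnj (u k j) * x j) * cnj (cnj (u k i) * x i)))"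
    by (rule sum.swap)
  also have "\<dots> = (\<Sum>k<N. \<Sum>j<N. \<Sum>i<N. complex_of_real (lam k) * ((cnj (u k j) * x j) * cnj (cnj (u k i) * x i)))"
    by (rule sum.cong[OF refl], rule sum.swap)
  also have "\<dots> = complex_of_real (\<Sum>k<N. lam k * (cmod (\<Sum>i<N. cnj (u k i) * x i))\<^sup>2)"
    unfolding of_real_sum of_real_mult complex_norm_square cnj_sum sum_product
    unfolding sum_distrib_left ..
  finally show ?thesis .
qed

text \<open>\<open>m\<close> is the overlap matrix of the eigenbasis of the output with the basis that diagonalizes
  \<open>\<omega>\<close>; \<open>g\<close> is the joint distribution obtained by measuring the latter on the output and the
  eigenbasis of the complementary output on the environment. Using \<open>ln x \<le> x - 1\<close> on each pair
  avoids operator monotonicity of the logarithm.\<close>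

lemma gibbs_coherent:
  fixes bet lam om :: "nat \<Rightarrow> real" and m g :: "nat \<Rightarrow> nat \<Rightarrow> real"
  assumes bet: "\<And>i. i < B \<Longrightarrow> bet i \<ge> 0" "(\<Sum>i<B. bet i) = 1"
    and lam: "\<And>k. k < K \<Longrightarrow> lam k \<ge> 0" "(\<Sum>k<K. lam k) = 1"
    and om: "\<And>j. j < B \<Longrightarrow> om j > 0"
    and m: "\<And>i j. m i j \<ge> 0" "\<And>i. i < B \<Longrightarrow> (\<Sum>j<B. m i j) = 1"
      "\<And>j. j < B \<Longrightarrow> (\<Sum>i<B. m i j) = 1"
    and g: "\<And>j k. g j k \<ge> 0" "\<And>k. k < K \<Longrightarrow> (\<Sum>j<B. g j k) = lam k"
    and marg: "\<And>j. j < B \<Longrightarrow> (\<Sum>k<K. g j k) = (\<Sum>i<B. bet i * m i j)"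
    and dom: "\<And>k. k < K \<Longrightarrow> (\<Sum>j<B. g j k / om j) \<le> 1"
  shows "(\<Sum>k<K. lam k * ln (lam k)) - (\<Sum>i<B. bet i * ln (bet i)) \<le> ln (\<Sum>j<B. om j)"
proof -
  define W where "W = (\<Sum>j<B. om j)"
  have "B \<noteq> 0" using bet(2) by (cases B) auto
  then have W: "W > 0" unfolding W_def using om by (intro sum_pos) auto
  have ln_ratio: "a * (ln x - ln y) \<le> a * (x / y) - a" if "a \<ge> 0" "x > 0" "y > 0" for a x y :: real
    using mult_left_mono[OF ln_le_minus_one[of "x / y"], of a] that
    by (simp add: ln_div algebra_simps)
  \<comment> \<open>Klein's inequality for the output state against \<open>om / W\<close>, taken
    term by term. It leads to \<open>p1\<close>: the output entropy plus the mean of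
    \<open>ln om\<close> is at most \<open>ln W\<close>.\<close>
  have part1: "(\<Sum>i<B. \<Sum>j<B. bet i * m i j * (ln (om j) - ln (bet i) - ln W))
      \<le> (\<Sum>i<B. \<Sum>j<B. m i j * om j / W - bet i * m i j)"
  proof (intro sum_mono)
    fix i j assume ij: "i \<in> {..<B}" "j \<in> {..<B}"
    show "bet i * m i j * (ln (om j) - ln (bet i) - ln W) \<le> m i j * om j / W - bet i * m i j"
    proof (cases "bet i = 0")
      case True then show ?thesis using m(1)[of i j] om[of j] ij W by simp
    next
      case False
      then have "bet i > 0" using bet(1)[of i] ij by simp
      then show ?thesis
        using ln_ratio[of "bet i * m i j" "om j" "bet i * W"] m(1)[of i j] om[of j] ij W
        by (simp add: ln_mult algebra_simps)
    qed
  qed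
  have "(\<Sum>i<B. \<Sum>j<B. m i j * om j / W) = (\<Sum>j<B. (\<Sum>i<B. m i j) * om j) / W"
    by (subst sum.swap) (simp add: sum_distrib_right sum_divide_distrib)
  also have "\<dots> = 1" using W by (simp add: m(3) W_def)
  finally have r1: "(\<Sum>i<B. \<Sum>j<B. m i j * om j / W) = 1" .
  have r2: "(\<Sum>i<B. \<Sum>j<B. bet i * m i j) = 1"
    by (simp add: sum_distrib_left[symmetric] m(2) bet(2))
  have "(\<Sum>i<B. \<Sum>j<B. bet i * m i j * (ln (om j) - ln (bet i) - ln W))
      = (\<Sum>j<B. (\<Sum>i<B. bet i * m i j) * ln (om j))
        - (\<Sum>i<B. bet i * ln (bet i) * (\<Sum>j<B. m i j)) - (\<Sum>i<B. \<Sum>j<B. bet i * m i j) * ln W"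
  proof -
    have "(\<Sum>j<B. (\<Sum>i<B. bet i * m i j) * ln (om j)) = (\<Sum>i<B. \<Sum>j<B. bet i * m i j * ln (om j))"
      by (subst sum.swap) (simp add: sum_distrib_right)
    then show ?thesis
      by (simp add: algebra_simps sum_subtractf sum_distrib_left sum_distrib_right)
  qed
  also have "\<dots> = (\<Sum>j<B. (\<Sum>k<K. g j k) * ln (om j)) - (\<Sum>i<B. bet i * ln (bet i)) - ln W"
    by (simp add: r2 m(2) marg)
  finally have p1: "(\<Sum>j<B. (\<Sum>k<K. g j k) * ln (om j)) - (\<Sum>i<B. bet i * ln (bet i)) - ln W \<le> 0"
    using part1 by (simp add: sum_subtractf r1 r2)
  \<comment> \<open>The same linearization compares the environment spectrum with \<open>om\<close>.
    Summed over \<open>j\<close> it gives \<open>lam k\<close> times the excess of the sum in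
    \<open>dom\<close> over 1, which is not positive.\<close>
  have "(\<Sum>k<K. \<Sum>j<B. g j k * (ln (lam k) - ln (om j))) \<le> (\<Sum>k<K. \<Sum>j<B. lam k * (g j k / om j) - g j k)"
  proof (intro sum_mono)
    fix k j assume kj: "k \<in> {..<K}" "j \<in> {..<B}"
    show "g j k * (ln (lam k) - ln (om j)) \<le> lam k * (g j k / om j) - g j k"
    proof (cases "lam k = 0")
      case True
      then have "g j k = 0"
        using g(2)[of k] kj sum_nonneg_eq_0_iff[of "{..<B}" "\<lambda>j. g j k"] g(1) by auto
      then show ?thesis by simp
    next
      case False
      then have "lam k > 0" using lam(1)[of k] kj by simp
      then show ?thesis using ln_ratio[of "g j k" "lam k" "om j"] g(1) om kj
        by (simp add: mult.commute)
    qed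
  qed
  also have "\<dots> = (\<Sum>k<K. lam k * (\<Sum>j<B. g j k / om j)) - 1"
    by (simp add: sum_subtractf sum_distrib_left g(2) lam(2))
  also have "\<dots> \<le> (\<Sum>k<K. lam k * 1) - 1"
    using dom lam(1) by (intro diff_right_mono sum_mono mult_left_mono) auto
  also have "\<dots> = 0" by (simp add: lam(2))
  finally have "(\<Sum>k<K. \<Sum>j<B. g j k * (ln (lam k) - ln (om j))) \<le> 0" .
  moreover have "(\<Sum>k<K. \<Sum>j<B. g j k * (ln (lam k) - ln (om j)))
      = (\<Sum>k<K. (\<Sum>j<B. g j k) * ln (lam k)) - (\<Sum>j<B. (\<Sum>k<K. g j k) * ln (om j))"
  proof -
    have "(\<Sum>j<B. (\<Sum>k<K. g j k) * ln (om j)) = (\<Sum>k<K. \<Sum>j<B. g j k * ln (om j))"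
      by (subst sum.swap) (simp add: sum_distrib_right)
    then show ?thesis by (simp add: algebra_simps sum_subtractf sum_distrib_left)
  qed
  ultimately show ?thesis
    using p1 by (simp add: g(2) W_def)
qed

lemma sum_rotate4:
  "(\<Sum>e\<in>A. \<Sum>l\<in>B. \<Sum>l'\<in>C. \<Sum>b\<in>D. \<Sum>b'\<in>E. f e l l' b b')
    = (\<Sum>l\<in>B. \<Sum>l'\<in>C. \<Sum>b\<in>D. \<Sum>b'\<in>E. \<Sum>e\<in>A. f e l l' b b')"
  by (subst sum.swap, rule sum.cong[OF refl], subst sum.swap, rule sum.cong[OF refl],
      subst sum.swap, rule sum.cong[OF refl], rule sum.swap)

text \<open>\<open>T l b e\<close> is the amplitude of a pure state on reference, output and environment. The hypothesis
  writes the partial transpose of its reference-output marginal as a signed sum of rank-one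
  operators; the sum without signs has marginal \<open>om\<close> on the output.\<close>

lemma coherent_information_bound:
  fixes T F :: "nat \<Rightarrow> nat \<Rightarrow> nat \<Rightarrow> complex" and eps :: "nat \<Rightarrow> real"
  assumes TF: "\<And>l l' b b'. l < NL \<Longrightarrow> l' < NL \<Longrightarrow> b < NB \<Longrightarrow> b' < NB \<Longrightarrow>
      (\<Sum>e<NE. T l b e * cnj (T l' b' e)) = (\<Sum>s<NS. complex_of_real (eps s) * (F s l b' * cnj (F s l' b)))"
    and eps: "\<And>s. s < NS \<Longrightarrow> \<bar>eps s\<bar> \<le> 1"
    and norm: "(\<Sum>l<NL. \<Sum>b<NB. \<Sum>e<NE. (cmod (T l b e))\<^sup>2) = 1"
  shows "vn_entropy (mat NB NB (\<lambda>(b, b'). \<Sum>l<NL. \<Sum>e<NE. T l b e * cnj (T l b' e)))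
      - vn_entropy (mat NE NE (\<lambda>(e, e'). \<Sum>l<NL. \<Sum>b<NB. T l b e * cnj (T l b e')))
    \<le> log 2 (\<Sum>s<NS. \<Sum>l<NL. \<Sum>b<NB. (cmod (F s l b))\<^sup>2)"
proof -
  define sB where "sB b b' = (\<Sum>l<NL. \<Sum>e<NE. T l b e * cnj (T l b' e))" for b b'
  define sE where "sE e e' = (\<Sum>l<NL. \<Sum>b<NB. T l b e * cnj (T l b e'))" for e e'
  \<comment> \<open>The conjugates encode the transpose on the output; the double one brings the sum
    into the shape of \<open>gram_quadratic\<close> for \<open>cnj (F s l b)\<close>.\<close>
  define om where "om b b' = (\<Sum>s<NS. \<Sum>l<NL. cnj (F s l b) * cnj (cnj (F s l b')))" for b b'
  define W where "W = (\<Sum>s<NS. \<Sum>l<NL. \<Sum>b<NB. (cmod (F s l b))\<^sup>2)"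
  obtain v bet where v: "eigsys NB sB v bet"
    by (rule spectral_hermitian[of NB sB]) (auto simp: sB_def mult.commute)
  obtain u lam where u: "eigsys NE sE u lam"
    by (rule spectral_hermitian[of NE sE]) (auto simp: sE_def mult.commute)
  obtain w th where w: "eigsys NB om w th"
    by (rule spectral_hermitian[of NB om]) (auto simp: om_def mult.commute)
  have onb_v: "onb NB v" and onb_u: "onb NE u" and onb_w: "onb NB w"
    using u v w by (auto simp: eigsys_def)

  \<comment> \<open>The unnormalized reference-output vector left when the environment is found in
    its eigenvector \<open>k\<close>; its squared norm is \<open>lam k\<close>, and these vectors
    decompose the marginal.\<close>
  define \<tau> where "\<tau> k l b = (\<Sum>e<NE. cnj (u k e) * T l b e)" for k l b
  define a where "a j k l = (\<Sum>b<NB. cnj (w j b) * \<tau> k l b)" for j k l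
  define g where "g j k = (\<Sum>l<NL. (cmod (a j k l))\<^sup>2)" for j k
  define m where "m i j = (cmod (\<Sum>b<NB. cnj (w j b) * v i b))\<^sup>2" for i j

  have bet: "bet i = (\<Sum>l<NL. \<Sum>e<NE. (cmod (\<Sum>b<NB. cnj (v i b) * T l b e))\<^sup>2)" if "i < NB" for i
    using eigsys_quadratic[OF v that] gram_quadratic[of "v i" "\<lambda>l e b. T l b e" NE NL NB]
    unfolding sB_def by (simp only: of_real_eq_iff)
  have lam: "lam k = (\<Sum>l<NL. \<Sum>b<NB. (cmod (\<tau> k l b))\<^sup>2)" if "k < NE" for k
    using eigsys_quadratic[OF u that] gram_quadratic[of "u k" "\<lambda>l b e. T l b e" NB NL NE]
    unfolding sE_def \<tau>_def by (simp only: of_real_eq_iff)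
  have th_nonneg: "th j \<ge> 0" if "j < NB" for j
  proof -
    have "th j = (\<Sum>s<NS. \<Sum>l<NL. (cmod (\<Sum>b<NB. cnj (w j b) * cnj (F s l b)))\<^sup>2)"
      using eigsys_quadratic[OF w that] gram_quadratic[of "w j" "\<lambda>s l b. cnj (F s l b)" NL NS NB]
      unfolding om_def by (simp only: of_real_eq_iff)
    then show ?thesis by (simp add: sum_nonneg)
  qed
  have sum_bet: "(\<Sum>i<NB. bet i) = 1"
  proof -
    have "complex_of_real (\<Sum>i<NB. bet i) = (\<Sum>b<NB. \<Sum>l<NL. \<Sum>e<NE. complex_of_real ((cmod (T l b e))\<^sup>2))"
      unfolding eigsys_trace[OF v, symmetric] sB_def complex_norm_square ..
    also have "\<dots> = complex_of_real (\<Sum>l<NL. \<Sum>b<NB. \<Sum>e<NE. (cmod (T l b e))\<^sup>2)"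
      by (subst sum.swap) (simp del: of_real_power)
    finally show ?thesis unfolding norm by (simp only: of_real_eq_iff)
  qed
  have sum_lam: "(\<Sum>k<NE. lam k) = 1"
  proof -
    have "complex_of_real (\<Sum>k<NE. lam k) = (\<Sum>e<NE. \<Sum>l<NL. \<Sum>b<NB. complex_of_real ((cmod (T l b e))\<^sup>2))"
      unfolding eigsys_trace[OF u, symmetric] sE_def complex_norm_square ..
    also have "\<dots> = (\<Sum>l<NL. \<Sum>e<NE. \<Sum>b<NB. complex_of_real ((cmod (T l b e))\<^sup>2))"
      by (rule sum.swap)
    also have "\<dots> = (\<Sum>l<NL. \<Sum>b<NB. \<Sum>e<NE. complex_of_real ((cmod (T l b e))\<^sup>2))"
      by (rule sum.cong[OF refl], rule sum.swap)
    also have "\<dots> = complex_of_real (\<Sum>l<NL. \<Sum>b<NB. \<Sum>e<NE. (cmod (T l b e))\<^sup>2)"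
      by (simp del: of_real_power)
    finally show ?thesis unfolding norm by (simp only: of_real_eq_iff)
  qed
  have sum_th: "(\<Sum>j<NB. th j) = W"
  proof -
    have "complex_of_real (\<Sum>j<NB. th j) = (\<Sum>b<NB. \<Sum>s<NS. \<Sum>l<NL. complex_of_real ((cmod (F s l b))\<^sup>2))"
      unfolding eigsys_trace[OF w, symmetric] om_def complex_norm_square by (simp add: mult.commute)
    also have "\<dots> = (\<Sum>s<NS. \<Sum>b<NB. \<Sum>l<NL. complex_of_real ((cmod (F s l b))\<^sup>2))"
      by (rule sum.swap)
    also have "\<dots> = (\<Sum>s<NS. \<Sum>l<NL. \<Sum>b<NB. complex_of_real ((cmod (F s l b))\<^sup>2))"
      by (rule sum.cong[OF refl], rule sum.swap)
    also have "\<dots> = complex_of_real W"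
      by (simp add: W_def del: of_real_power)
    finally show ?thesis by (simp only: of_real_eq_iff)
  qed
  have m_row: "(\<Sum>j<NB. m i j) = 1" if "i < NB" for i
  proof -
    have "complex_of_real (\<Sum>b<NB. (cmod (v i b))\<^sup>2) = 1"
      using onb_v that by (simp add: onb_def complex_norm_square del: of_real_power)
    then show ?thesis
      unfolding m_def parseval[OF onb_w] by (simp only: of_real_eq_1_iff)
  qed
  have m_col: "(\<Sum>i<NB. m i j) = 1" if "j < NB" for j
  proof -
    have "m i j = (cmod (\<Sum>b<NB. cnj (v i b) * w j b))\<^sup>2" for i
    proof -
      have "(\<Sum>b<NB. cnj (w j b) * v i b) = cnj (\<Sum>b<NB. cnj (v i b) * w j b)"
        by (simp add: mult.commute)
      then show ?thesis unfolding m_def by (simp only: complex_mod_cnj)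
    qed
    then have "(\<Sum>i<NB. m i j) = (\<Sum>b<NB. (cmod (w j b))\<^sup>2)"
      by (simp add: parseval[OF onb_v])
    moreover have "complex_of_real (\<Sum>b<NB. (cmod (w j b))\<^sup>2) = 1"
      using onb_w that by (simp add: onb_def complex_norm_square del: of_real_power)
    ultimately show ?thesis by (simp only: of_real_eq_1_iff)
  qed
  have g_col: "(\<Sum>j<NB. g j k) = lam k" if "k < NE" for k
  proof -
    have "(\<Sum>j<NB. g j k) = (\<Sum>l<NL. \<Sum>j<NB. (cmod (a j k l))\<^sup>2)"
      unfolding g_def by (rule sum.swap)
    also have "\<dots> = lam k"
      unfolding a_def parseval[OF onb_w] lam[OF that] ..
    finally show ?thesis .
  qed
  have g_row: "(\<Sum>k<NE. g j k) = (\<Sum>i<NB. bet i * m i j)" if "j < NB" for j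
  proof -
    have a_alt: "a j k l = (\<Sum>e<NE. cnj (u k e) * (\<Sum>b<NB. cnj (w j b) * T l b e))" for k l
      unfolding a_def \<tau>_def sum_distrib_left by (subst sum.swap) (simp add: mult_ac)
    have "(\<Sum>k<NE. g j k) = (\<Sum>l<NL. \<Sum>k<NE. (cmod (a j k l))\<^sup>2)"
      unfolding g_def by (rule sum.swap)
    also have "\<dots> = (\<Sum>l<NL. \<Sum>e<NE. (cmod (\<Sum>b<NB. cnj (w j b) * T l b e))\<^sup>2)"
      unfolding a_alt parseval[OF onb_u] ..
    finally have q: "(\<Sum>k<NE. g j k) = (\<Sum>l<NL. \<Sum>e<NE. (cmod (\<Sum>b<NB. cnj (w j b) * T l b e))\<^sup>2)" .
    have "complex_of_real (\<Sum>k<NE. g j k) = (\<Sum>b<NB. \<Sum>b'<NB. cnj (w j b) * sB b b' * w j b')"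
      unfolding q sB_def gram_quadratic[of "w j" "\<lambda>l e b. T l b e", symmetric] ..
    also have "\<dots> = complex_of_real (\<Sum>i<NB. bet i * (cmod (\<Sum>b<NB. cnj (v i b) * w j b))\<^sup>2)"
      by (rule eigsys_quadratic_form[OF v])
    finally have "(\<Sum>k<NE. g j k) = (\<Sum>i<NB. bet i * (cmod (\<Sum>b<NB. cnj (v i b) * w j b))\<^sup>2)"
      by (simp only: of_real_eq_iff)
    also have "\<dots> = (\<Sum>i<NB. bet i * m i j)"
    proof (rule sum.cong[OF refl])
      fix i
      have "(\<Sum>b<NB. cnj (w j b) * v i b) = cnj (\<Sum>b<NB. cnj (v i b) * w j b)"
        by (simp add: mult.commute)
      then show "bet i * (cmod (\<Sum>b<NB. cnj (v i b) * w j b))\<^sup>2 = bet i * m i j"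
        unfolding m_def by (simp only: complex_mod_cnj)
    qed
    finally show ?thesis .
  qed

  define D where "D = (\<Sum>k<NE. lam k * ln (lam k)) - (\<Sum>i<NB. bet i * ln (bet i))"
  \<comment> \<open>The shift by \<open>\<delta>\<close> makes \<open>om\<close> invertible.\<close>
  have D_le: "D \<le> ln (W + real NB * \<delta>)" if \<delta>: "\<delta> > 0" for \<delta>
  proof -
    define om' where "om' j = th j + \<delta>" for j
    have om'_pos: "om' j > 0" if "j < NB" for j
      using th_nonneg[OF that] \<delta> by (simp add: om'_def)
    \<comment> \<open>With \<open>x = \<omega>\<^sup>-\<^sup>1 \<tau>\<close> and \<open>c = \<langle>x, \<tau>\<rangle>\<close>, the domination of the marginal by \<open>1 \<otimes> \<omega>\<close> gives \<open>c\<^sup>2 \<le> c\<close>.\<close>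
    have dom: "(\<Sum>j<NB. g j k / om' j) \<le> 1" if k: "k < NE" for k
    proof -
      define c where "c = (\<Sum>j<NB. g j k / om' j)"
      define x where "x l b = (\<Sum>j<NB. a j k l / complex_of_real (om' j) * w j b)" for l b
      \<comment> \<open>The squared norm of \<open>Y\<close> is the expectation of the
        reference-output marginal in the vector \<open>x\<close>, while its component along
        \<open>u k\<close> is \<open>c\<close>.\<close>
      define Y where "Y e = (\<Sum>l<NL. \<Sum>b<NB. cnj (x l b) * T l b e)" for e
      define G where "G s l l' = (\<Sum>b<NB. F s l b * x l' b)" for s l l'
      have c_nonneg: "c \<ge> 0"
        unfolding c_def g_def by (intro sum_nonneg divide_nonneg_pos om'_pos) auto
      have w_x: "(\<Sum>b<NB. cnj (w j b) * x l b) = a j k l / complex_of_real (om' j)" if "j < NB" for j l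
      proof -
        have "(\<Sum>b<NB. cnj (w j b) * x l b)
            = (\<Sum>b<NB. \<Sum>i<NB. a i k l / complex_of_real (om' i) * (w i b * cnj (w j b)))"
          by (simp add: x_def sum_distrib_left mult_ac)
        also have "\<dots> = (\<Sum>i<NB. a i k l / complex_of_real (om' i) * (\<Sum>b<NB. w i b * cnj (w j b)))"
          unfolding sum_distrib_left by (rule sum.swap)
        also have "\<dots> = (\<Sum>i<NB. if i = j then a i k l / complex_of_real (om' i) else 0)"
          using onb_w that by (intro sum.cong) (auto simp: onb_def)
        also have "\<dots> = a j k l / complex_of_real (om' j)" using that by simp
        finally show ?thesis .
      qed
      have "(\<Sum>e<NE. cnj (u k e) * Y e) = (\<Sum>e<NE. \<Sum>l<NL. \<Sum>b<NB. cnj (x l b) * (cnj (u k e) * T l b e))"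
        by (simp add: Y_def sum_distrib_left mult_ac)
      also have "\<dots> = (\<Sum>l<NL. \<Sum>b<NB. cnj (x l b) * \<tau> k l b)"
        unfolding \<tau>_def sum_distrib_left
        by (subst sum.swap, rule sum.cong[OF refl], rule sum.swap)
      also have "\<dots> = (\<Sum>l<NL. \<Sum>b<NB. \<Sum>j<NB. cnj (a j k l) / complex_of_real (om' j) * (cnj (w j b) * \<tau> k l b))"
        by (simp add: x_def sum_distrib_left sum_distrib_right mult_ac)
      also have "\<dots> = (\<Sum>l<NL. \<Sum>j<NB. cnj (a j k l) / complex_of_real (om' j) * a j k l)"
        unfolding a_def sum_distrib_left by (rule sum.cong[OF refl], rule sum.swap)
      also have "\<dots> = (\<Sum>j<NB. \<Sum>l<NL. cnj (a j k l) / complex_of_real (om' j) * a j k l)"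
        by (rule sum.swap)
      also have "\<dots> = (\<Sum>j<NB. \<Sum>l<NL. complex_of_real ((cmod (a j k l))\<^sup>2) / complex_of_real (om' j))"
        by (simp add: complex_norm_square mult.commute del: of_real_power)
      also have "\<dots> = complex_of_real c"
        by (simp add: c_def g_def sum_divide_distrib del: of_real_power)
      finally have uY: "(\<Sum>e<NE. cnj (u k e) * Y e) = complex_of_real c" .
      have "c\<^sup>2 = (cmod (\<Sum>e<NE. cnj (u k e) * Y e))\<^sup>2"
        using c_nonneg by (simp add: uY)
      also have "\<dots> \<le> (\<Sum>k<NE. (cmod (\<Sum>e<NE. cnj (u k e) * Y e))\<^sup>2)"
        using k by (intro member_le_sum) auto
      also have "\<dots> = (\<Sum>e<NE. (cmod (Y e))\<^sup>2)"
        by (rule parseval[OF onb_u])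
      finally have c_Y: "c\<^sup>2 \<le> (\<Sum>e<NE. (cmod (Y e))\<^sup>2)" .
      \<comment> \<open>Since \<open>TF\<close> exchanges \<open>b\<close> and \<open>b'\<close>,
        each \<open>F\<close> is contracted with the \<open>x\<close> of the other reference index;
        thus \<open>G s l l'\<close> is paired with \<open>G s l' l\<close> instead of with
        itself.\<close>
      have Y_G: "complex_of_real (\<Sum>e<NE. (cmod (Y e))\<^sup>2)
          = (\<Sum>s<NS. \<Sum>l<NL. \<Sum>l'<NL. complex_of_real (eps s) * (G s l l' * cnj (G s l' l)))"
      proof -
        have "complex_of_real (\<Sum>e<NE. (cmod (Y e))\<^sup>2) = (\<Sum>e<NE. Y e * cnj (Y e))"
          by (simp add: complex_norm_square del: of_real_power)
        also have "\<dots> = (\<Sum>e<NE. \<Sum>l<NL. \<Sum>l'<NL. \<Sum>b<NB. \<Sum>b'<NB.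
            (cnj (x l b) * T l b e) * cnj (cnj (x l' b') * T l' b' e))"
          unfolding Y_def cnj_sum sum_product ..
        also have "\<dots> = (\<Sum>l<NL. \<Sum>l'<NL. \<Sum>b<NB. \<Sum>b'<NB. \<Sum>e<NE.
            (cnj (x l b) * T l b e) * cnj (cnj (x l' b') * T l' b' e))"
          by (rule sum_rotate4)
        also have "\<dots> = (\<Sum>l<NL. \<Sum>l'<NL. \<Sum>b<NB. \<Sum>b'<NB.
            cnj (x l b) * x l' b' * (\<Sum>e<NE. T l b e * cnj (T l' b' e)))"
          by (simp add: sum_distrib_left mult_ac)
        also have "\<dots> = (\<Sum>l<NL. \<Sum>l'<NL. \<Sum>b<NB. \<Sum>b'<NB. \<Sum>s<NS.
            complex_of_real (eps s) * (cnj (F s l' b * x l b) * (F s l b' * x l' b')))"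
          by (auto intro!: sum.cong simp: TF sum_distrib_left mult_ac)
        also have "\<dots> = (\<Sum>s<NS. \<Sum>l<NL. \<Sum>l'<NL. \<Sum>b<NB. \<Sum>b'<NB.
            complex_of_real (eps s) * (cnj (F s l' b * x l b) * (F s l b' * x l' b')))"
          by (rule sum_rotate4[symmetric])
        also have "\<dots> = (\<Sum>s<NS. \<Sum>l<NL. \<Sum>l'<NL. complex_of_real (eps s) * (cnj (G s l' l) * G s l l'))"
          unfolding G_def cnj_sum sum_product unfolding sum_distrib_left ..
        finally show ?thesis by (simp only: mult.commute[of "cnj _" "G _ _ _"])
      qed
      have "(\<Sum>e<NE. (cmod (Y e))\<^sup>2) = cmod (complex_of_real (\<Sum>e<NE. (cmod (Y e))\<^sup>2))"
        by (subst norm_of_real) (simp add: sum_nonneg)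
      also have "\<dots> \<le> (\<Sum>s<NS. \<Sum>l<NL. \<Sum>l'<NL. cmod (complex_of_real (eps s) * (G s l l' * cnj (G s l' l))))"
        unfolding Y_G by (intro order_trans[OF norm_sum] sum_mono order_refl)
      also have "\<dots> \<le> (\<Sum>s<NS. \<Sum>l<NL. \<Sum>l'<NL. ((cmod (G s l l'))\<^sup>2 + (cmod (G s l' l))\<^sup>2) / 2)"
      proof (intro sum_mono)
        fix s l l' assume "s \<in> {..<NS}"
        then have "\<bar>eps s\<bar> * (cmod (G s l l') * cmod (G s l' l)) \<le> 1 * (cmod (G s l l') * cmod (G s l' l))"
          using eps by (intro mult_right_mono) auto
        moreover have "2 * (cmod (G s l l') * cmod (G s l' l)) \<le> (cmod (G s l l'))\<^sup>2 + (cmod (G s l' l))\<^sup>2"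
          using sum_squares_bound[of "cmod (G s l l')" "cmod (G s l' l)"] by (simp add: mult.assoc)
        ultimately show "cmod (complex_of_real (eps s) * (G s l l' * cnj (G s l' l)))
            \<le> ((cmod (G s l l'))\<^sup>2 + (cmod (G s l' l))\<^sup>2) / 2"
          by (simp add: norm_mult)
      qed
      also have "\<dots> = (\<Sum>s<NS. \<Sum>l<NL. \<Sum>l'<NL. (cmod (G s l l'))\<^sup>2)"
      proof (rule sum.cong[OF refl])
        fix s
        have "(\<Sum>l<NL. \<Sum>l'<NL. (cmod (G s l' l))\<^sup>2) = (\<Sum>l<NL. \<Sum>l'<NL. (cmod (G s l l'))\<^sup>2)"
          by (rule sum.swap)
        then show "(\<Sum>l<NL. \<Sum>l'<NL. ((cmod (G s l l'))\<^sup>2 + (cmod (G s l' l))\<^sup>2) / 2)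
            = (\<Sum>l<NL. \<Sum>l'<NL. (cmod (G s l l'))\<^sup>2)"
          by (simp add: sum.distrib sum_divide_distrib[symmetric])
      qed
      also have "\<dots> = (\<Sum>l'<NL. \<Sum>s<NS. \<Sum>l<NL. (cmod (G s l l'))\<^sup>2)"
        by (subst (2) sum.swap, rule sum.cong[OF refl], rule sum.swap)
      also have "\<dots> = (\<Sum>l'<NL. \<Sum>j<NB. th j * (cmod (a j k l' / complex_of_real (om' j)))\<^sup>2)"
      proof (rule sum.cong[OF refl])
        fix l'
        have G_cnj: "cmod (G s l l') = cmod (\<Sum>b<NB. cnj (x l' b) * cnj (F s l b))" for s l
        proof -
          have "(\<Sum>b<NB. cnj (x l' b) * cnj (F s l b)) = cnj (G s l l')"
            by (simp add: G_def mult.commute)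
          then show ?thesis by simp
        qed
        have "complex_of_real (\<Sum>s<NS. \<Sum>l<NL. (cmod (G s l l'))\<^sup>2)
            = (\<Sum>b<NB. \<Sum>b'<NB. cnj (x l' b) * om b b' * x l' b')"
          unfolding G_cnj om_def
          by (rule gram_quadratic[of "x l'" "\<lambda>s l b. cnj (F s l b)", symmetric])
        also have "\<dots> = complex_of_real (\<Sum>j<NB. th j * (cmod (\<Sum>b<NB. cnj (w j b) * x l' b))\<^sup>2)"
          by (rule eigsys_quadratic_form[OF w])
        finally have "(\<Sum>s<NS. \<Sum>l<NL. (cmod (G s l l'))\<^sup>2)
            = (\<Sum>j<NB. th j * (cmod (\<Sum>b<NB. cnj (w j b) * x l' b))\<^sup>2)"
          by (simp only: of_real_eq_iff)
        then show "(\<Sum>s<NS. \<Sum>l<NL. (cmod (G s l l'))\<^sup>2)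
            = (\<Sum>j<NB. th j * (cmod (a j k l' / complex_of_real (om' j)))\<^sup>2)"
          by (simp add: w_x)
      qed
      also have "\<dots> \<le> (\<Sum>l'<NL. \<Sum>j<NB. (cmod (a j k l'))\<^sup>2 / om' j)"
      proof (intro sum_mono)
        fix l' j assume j: "j \<in> {..<NB}"
        have "th j * (cmod (a j k l' / complex_of_real (om' j)))\<^sup>2
            \<le> om' j * (cmod (a j k l' / complex_of_real (om' j)))\<^sup>2"
          using \<delta> by (intro mult_right_mono) (auto simp: om'_def)
        also have "\<dots> = (cmod (a j k l'))\<^sup>2 / om' j"
          using om'_pos[of j] j by (simp add: norm_divide power2_eq_square)
        finally show "th j * (cmod (a j k l' / complex_of_real (om' j)))\<^sup>2 \<le> (cmod (a j k l'))\<^sup>2 / om' j" .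
      qed
      also have "\<dots> = c"
        unfolding c_def g_def sum_divide_distrib by (rule sum.swap)
      finally have "c\<^sup>2 \<le> c" using c_Y by simp
      then show ?thesis
        using c_nonneg unfolding c_def[symmetric] by (cases "c = 0") (auto simp: power2_eq_square)
    qed
    have "D \<le> ln (\<Sum>j<NB. om' j)"
      unfolding D_def
    proof (rule gibbs_coherent[where m = m and g = g])
      show "bet i \<ge> 0" if "i < NB" for i using bet[OF that] by (simp add: sum_nonneg)
      show "lam k \<ge> 0" if "k < NE" for k using lam[OF that] by (simp add: sum_nonneg)
      show "m i j \<ge> 0" for i j by (simp add: m_def)
      show "g j k \<ge> 0" for j k by (simp add: g_def sum_nonneg)
    qed (fact sum_bet sum_lam om'_pos m_row m_col g_col g_row dom)+
    then show ?thesis by (simp add: om'_def sum.distrib sum_th)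
  qed
  have W_nonneg: "W \<ge> 0" by (simp add: W_def sum_nonneg)
  \<comment> \<open>The limit of small shifts is taken in exponential form because
    \<open>ln W\<close> is meaningful only for positive \<open>W\<close>; the positivity of
    \<open>W\<close> then comes out as a consequence.\<close>
  have "exp D \<le> W"
  proof (rule field_le_epsilon)
    fix e :: real assume e: "e > 0"
    define \<delta> where "\<delta> = e / (real NB + 1)"
    have \<delta>: "\<delta> > 0" "real NB * \<delta> \<le> e" using e by (auto simp: \<delta>_def field_simps)
    have NB: "NB > 0" using sum_bet by (cases NB) auto
    then have "W + real NB * \<delta> > 0" using W_nonneg \<delta> by (intro add_nonneg_pos) auto
    then have "exp D \<le> W + real NB * \<delta>"
      using D_le[OF \<delta>(1)] by (metis exp_le_cancel_iff exp_ln)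
    then show "exp D \<le> W + e" using \<delta> by simp
  qed
  moreover from this have "W > 0"
    using exp_gt_zero[of D] by linarith
  ultimately have W: "W > 0" "D \<le> ln W"
    by (auto simp: ln_ge_iff)
  have eta: "eta x = x * ln x / ln 2" if "x \<ge> 0" for x
    using that by (auto simp: eta_def log_def)
  have "vn_entropy (mat NB NB (\<lambda>(b, b'). sB b b')) - vn_entropy (mat NE NE (\<lambda>(e, e'). sE e e'))
      = (\<Sum>k<NE. eta (lam k)) - (\<Sum>i<NB. eta (bet i))"
    by (simp add: vn_entropy_eigsys[OF v] vn_entropy_eigsys[OF u])
  also have "\<dots> = (\<Sum>k<NE. lam k * ln (lam k) / ln 2) - (\<Sum>i<NB. bet i * ln (bet i) / ln 2)"
    by (intro arg_cong2[of _ _ _ _ "(-)"] sum.cong refl eta) (auto simp: lam bet sum_nonneg)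
  also have "\<dots> = D / ln 2"
    by (simp add: D_def sum_divide_distrib diff_divide_distrib)
  also have "\<dots> \<le> log 2 W" using W by (simp add: log_def divide_right_mono)
  finally show ?thesis unfolding sB_def sE_def W_def .
qed

subsection \<open>Digit expansions and the partial transpose of the platypus Choi matrix\<close>

lemma sum_mod_div:
  fixes f :: "nat \<Rightarrow> nat \<Rightarrow> 'a::comm_monoid_add"
  assumes "M > 0"
  shows "(\<Sum>x<M * N. f (x mod M) (x div M)) = (\<Sum>i<M. \<Sum>j<N. f i j)"
  unfolding sum.cartesian_product
proof (rule sum.reindex_bij_witness[of _ "\<lambda>(i, j). i + M * j" "\<lambda>x. (x mod M, x div M)"])
  fix y assume "y \<in> {..<M} \<times> {..<N}"
  then obtain i j where y: "y = (i, j)" "i < M" "Suc j \<le> N" by auto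
  have "i + M * j < M * Suc j" using y by simp
  also have "\<dots> \<le> M * N" using y by (intro mult_left_mono) auto
  finally show "(case y of (i, j) \<Rightarrow> i + M * j) \<in> {..<M * N}" by (simp add: y)
qed (use assms in \<open>auto simp: less_mult_imp_div_less mult.commute\<close>)

lemma dig_less: "b > 0 \<Longrightarrow> dig b x k < b"
  by (simp add: dig_def)

lemma dig_mod:
  assumes "k < m" shows "dig b (x mod b ^ m) k = dig b x k"
proof (cases "b = 0")
  case False
  have "b ^ m = b ^ k * (b * b ^ (m - k - 1))"
    using assms by (metis Suc_diff_Suc Suc_eq_plus1 add_diff_inverse_nat diff_diff_left not_less_iff_gr_or_eq power_Suc power_add)
  then have "x mod b ^ m div b ^ k = x div b ^ k mod (b * b ^ (m - k - 1))"
    using False by (simp add: mod_mult2_eq)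
  then show ?thesis by (simp add: dig_def mod_mod_cancel)
next
  case True
  then show ?thesis using assms by (cases m) (auto simp: dig_def)
qed

lemma dig_div: "dig b (x div b ^ m) k = dig b x (m + k)"
  by (simp add: dig_def div_mult2_eq power_add)

text \<open>Distributivity read along digits. It reduces each identity for \<open>n\<close> copies
  to its single-copy version.\<close>

lemma sum_prod_dig:
  fixes g :: "nat \<Rightarrow> nat \<Rightarrow> 'a::comm_semiring_1"
  assumes b: "b > 0"
  shows "(\<Sum>x<b ^ n. \<Prod>k<n. g k (dig b x k)) = (\<Prod>k<n. \<Sum>y<b. g k y)"
proof (induction n)
  case (Suc n)
  have "(\<Sum>x<b ^ Suc n. \<Prod>k<Suc n. g k (dig b x k))
      = (\<Sum>x<b ^ n * b. (\<Prod>k<n. g k (dig b (x mod b ^ n) k)) * g n (x div b ^ n mod b))"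
    by (intro sum.cong) (auto simp: dig_mod mult.commute dig_def[of b _ n])
  also have "\<dots> = (\<Sum>x<b ^ n. \<Sum>y<b. (\<Prod>k<n. g k (dig b x k)) * g n (y mod b))"
    using b by (subst sum_mod_div) auto
  also have "\<dots> = (\<Prod>k<Suc n. \<Sum>y<b. g k y)"
    by (simp add: Suc sum_product[symmetric])
  finally show ?case .
qed simp

lemma dig_inject:
  assumes "x < b ^ n" "y < b ^ n" "\<And>k. k < n \<Longrightarrow> dig b x k = dig b y k"
  shows "x = y"
  using assms
proof (induction n arbitrary: x y)
  case (Suc n)
  then have b: "b > 0" by (cases b) auto
  have "x mod b ^ n = y mod b ^ n"
  proof (rule Suc.IH)
    show "dig b (x mod b ^ n) k = dig b (y mod b ^ n) k" if "k < n" for k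
      using Suc.prems(3)[of k] that by (simp only: dig_mod less_SucI)
  qed (use b in simp_all)
  moreover have "x div b ^ n = y div b ^ n"
  proof -
    have "x div b ^ n < b" "y div b ^ n < b"
      using Suc.prems(1,2) by (auto intro: less_mult_imp_div_less)
    then show ?thesis using Suc.prems(3)[of n] by (simp add: dig_def)
  qed
  ultimately show ?case by (metis div_mult_mod_eq)
qed simp

lemma prod_dig_delta:
  fixes c :: "nat \<Rightarrow> 'a::comm_semiring_1"
  assumes "x < b ^ n" "y < b ^ n"
  shows "(\<Prod>k<n. if dig b x k = dig b y k then c (dig b x k) else 0)
    = (if x = y then \<Prod>k<n. c (dig b x k) else 0)"
proof (cases "x = y")
  case False
  then obtain k where "k < n" "dig b x k \<noteq> dig b y k"
    using dig_inject[OF assms] by blast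
  then show ?thesis using False by (auto intro!: prod_zero)
qed simp

text \<open>Applied with all \<open>c i = 1\<close> to the tensor power of the isometry, which
  preserves norms, and with \<open>c = plat_cn\<close> to the vectors of the signed decomposition,
  where it evaluates the trace of omega.\<close>

lemma orthogonal_norm:
  fixes K :: "nat \<Rightarrow> nat \<Rightarrow> nat \<Rightarrow> complex" and c :: "nat \<Rightarrow> real"
  assumes "\<And>i j. i < N \<Longrightarrow> j < N \<Longrightarrow>
    (\<Sum>p<P. \<Sum>q<Q. K p q i * cnj (K p q j)) = (if i = j then complex_of_real (c i) else 0)"
  shows "(\<Sum>p<P. \<Sum>q<Q. (cmod (\<Sum>i<N. K p q i * x i))\<^sup>2) = (\<Sum>i<N. c i * (cmod (x i))\<^sup>2)"
proof -
  have "complex_of_real (\<Sum>p<P. \<Sum>q<Q. (cmod (\<Sum>i<N. K p q i * x i))\<^sup>2)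
      = (\<Sum>i<N. \<Sum>j<N. x i * (\<Sum>p<P. \<Sum>q<Q. K p q i * cnj (K p q j)) * cnj (x j))"
    using gram_quadratic[of "\<lambda>i. cnj (x i)" K Q P N] by (simp add: mult.commute del: of_real_power)
  also have "\<dots> = (\<Sum>i<N. \<Sum>j<N. if j = i then complex_of_real (c i) * (x i * cnj (x i)) else 0)"
    using assms by (intro sum.cong) auto
  also have "\<dots> = complex_of_real (\<Sum>i<N. c i * (cmod (x i))\<^sup>2)"
    by (simp add: complex_norm_square del: of_real_power)
  finally show ?thesis by (simp only: of_real_eq_iff)
qed

lemma sum_lessThan_add:
  fixes h :: "nat \<Rightarrow> 'a::comm_monoid_add"
  shows "(\<Sum>i<m + n. h i) = (\<Sum>i<m. h i) + (\<Sum>i<n. h (m + i))"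
  by (induction n) (simp_all add: add.assoc)

text \<open>The partial transpose of the Choi matrix is diagonal except for \<open>|w\<rangle>\<langle>0,d| + |0,d\<rangle>\<langle>w|\<close>, where
  \<open>w = \<Sum>j. sqrt (mu j) |j+1, j\<rangle>\<close> is a unit vector. The last two vectors diagonalize that part with
  signs \<open>+\<close> and \<open>-\<close>; the weight \<open>t\<close> balances the contributions of the inputs \<open>0\<close> and \<open>i \<ge> 1\<close>.\<close>

definition plat_f :: "nat \<Rightarrow> (nat \<Rightarrow> real) \<Rightarrow> real \<Rightarrow> nat \<Rightarrow> nat \<Rightarrow> nat \<Rightarrow> real" where
  "plat_f d mu t s a b =
    (if s < d then (if a = 0 \<and> b = s then sqrt (mu s) else 0)
     else if s < 2 * d then (if a = Suc (s - d) \<and> b = d then 1 else 0)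
     else ((if a = 0 \<and> b = d then sqrt t else 0)
       + (if s = 2 * d then 1 else - 1) * (if a = Suc b \<and> b < d then sqrt (mu b / t) else 0)) / sqrt 2)"

definition plat_eps :: "nat \<Rightarrow> nat \<Rightarrow> real" where
  "plat_eps d s = (if s = 2 * d + 1 then - 1 else 1)"

lemma sum_plat_index:
  fixes h :: "nat \<Rightarrow> 'a::comm_monoid_add"
  shows "(\<Sum>s<2 * d + 2. h s) = (\<Sum>s<d. h s) + (\<Sum>s<d. h (d + s)) + h (2 * d) + h (2 * d + 1)"
  using sum_lessThan_add[of h d d] by (simp add: mult_2)

lemma plat_f_simps:
  "s < d \<Longrightarrow> plat_f d mu t s a b = (if a = 0 \<and> b = s then sqrt (mu s) else 0)"
  "s < d \<Longrightarrow> plat_f d mu t (d + s) a b = (if a = Suc s \<and> b = d then 1 else 0)"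
  "plat_f d mu t (2 * d) a b = ((if a = 0 \<and> b = d then sqrt t else 0)
       + (if a = Suc b \<and> b < d then sqrt (mu b / t) else 0)) / sqrt 2"
  "plat_f d mu t (2 * d + 1) a b = ((if a = 0 \<and> b = d then sqrt t else 0)
       - (if a = Suc b \<and> b < d then sqrt (mu b / t) else 0)) / sqrt 2"
  by (auto simp: plat_f_def)

lemma plat_eps_simps:
  "s < d \<Longrightarrow> plat_eps d s = 1" "s < d \<Longrightarrow> plat_eps d (d + s) = 1"
  "plat_eps d (2 * d) = 1" "plat_eps d (2 * d + 1) = -1"
  by (auto simp: plat_eps_def)

text \<open>The entries of the isometry are real, so conjugations disappear and the identities for
  one copy can be checked over the reals.\<close>

definition plat_vr :: "nat \<Rightarrow> (nat \<Rightarrow> real) \<Rightarrow> nat \<Rightarrow> nat \<Rightarrow> nat \<Rightarrow> real" where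
  "plat_vr d mu b e a =
     (if a = 0 then (if b = e \<and> b < d then sqrt (mu b) else 0)
      else if a \<le> d \<and> b = d \<and> e = a - 1 then 1 else 0)"

lemma platypus_V_real: "platypus_V d mu b e a = complex_of_real (plat_vr d mu b e a)"
  by (auto simp: platypus_V_def plat_vr_def)

lemma sum_delta_conj:
  fixes h :: "nat \<Rightarrow> real"
  shows "(\<Sum>e<d. if x = e \<and> P then h e else 0) = (if x < d \<and> P then h x else 0)"
    "(\<Sum>e<d. if e = x \<and> P then h e else 0) = (if x < d \<and> P then h x else 0)"
  by auto

lemma plat_transpose_single:
  assumes mu: "\<And>i. i < d \<Longrightarrow> mu i \<ge> 0" and t: "t > 0"
    and a: "a \<le> d" "a' \<le> d" and b: "b \<le> d" "b' \<le> d"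
  shows "(\<Sum>e<d. plat_vr d mu b e a * plat_vr d mu b' e a')
    = (\<Sum>s<2 * d + 2. plat_eps d s * (plat_f d mu t s a b' * plat_f d mu t s a' b))"
proof -
  define p where "p a b = (if a = 0 \<and> b = d then sqrt t else 0)" for a b :: nat
  define q where "q a b = (if a = Suc b \<and> b < d then sqrt (mu b / t) else 0)" for a b
  \<comment> \<open>Half the difference of the products formed from \<open>p + q\<close> and from
    \<open>p - q\<close> keeps only the cross terms; these are the off-diagonal entries.\<close>
  have R: "(\<Sum>s<2 * d + 2. plat_eps d s * (plat_f d mu t s a b' * plat_f d mu t s a' b))
      = (if a = 0 \<and> a' = 0 \<and> b = b' \<and> b < d then mu b else 0)
        + (if a = a' \<and> a \<noteq> 0 \<and> b = d \<and> b' = d then 1 else 0)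
        + (p a b' * q a' b + q a b' * p a' b)"
  proof -
    have "(\<Sum>s<d. plat_eps d s * (plat_f d mu t s a b' * plat_f d mu t s a' b))
        = (\<Sum>s<d. if b = s \<and> (a = 0 \<and> a' = 0 \<and> b = b') then mu s else 0)"
      by (rule sum.cong) (auto simp: plat_f_simps plat_eps_simps mu)
    also have "\<dots> = (if a = 0 \<and> a' = 0 \<and> b = b' \<and> b < d then mu b else 0)"
      by (subst sum_delta_conj) auto
    finally have 1: "(\<Sum>s<d. plat_eps d s * (plat_f d mu t s a b' * plat_f d mu t s a' b)) = \<dots>" .
    have "(\<Sum>s<d. plat_eps d (d + s) * (plat_f d mu t (d + s) a b' * plat_f d mu t (d + s) a' b))
        = (\<Sum>s<d. if a - 1 = s \<and> (a \<noteq> 0 \<and> a = a' \<and> b = d \<and> b' = d) then 1 else 0)"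
      by (rule sum.cong) (auto simp: plat_f_simps plat_eps_simps)
    also have "\<dots> = (if a = a' \<and> a \<noteq> 0 \<and> b = d \<and> b' = d then 1 else 0)"
      using a by (subst sum_delta_conj) auto
    finally have 2: "(\<Sum>s<d. plat_eps d (d + s) * (plat_f d mu t (d + s) a b' * plat_f d mu t (d + s) a' b)) = \<dots>" .
    show ?thesis
      unfolding sum_plat_index 1 2 plat_f_simps(3,4) plat_eps_simps(3,4) p_def[symmetric] q_def[symmetric]
      by (simp add: algebra_simps add_divide_distrib[symmetric] diff_divide_distrib[symmetric])
  qed
  \<comment> \<open>The weight cancels in the cross terms, so the signed identity holds for every
    positive \<open>t\<close>; only the unsigned sum depends on it.\<close>
  have tq: "sqrt t * sqrt (mu i / t) = sqrt (mu i)" for i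
    using t by (simp flip: real_sqrt_mult)
  consider "a = 0" "a' = 0" | "a = 0" "a' \<noteq> 0" | "a \<noteq> 0" "a' = 0" | "a \<noteq> 0" "a' \<noteq> 0" by blast
  then show ?thesis
  proof cases
    case 1
    have "(\<Sum>e<d. plat_vr d mu b e a * plat_vr d mu b' e a')
        = (\<Sum>e<d. if b = e \<and> b = b' then mu e else 0)"
      using 1 by (intro sum.cong) (auto simp: plat_vr_def mu)
    then show ?thesis unfolding R using 1 by (subst (asm) sum_delta_conj) (auto simp: p_def q_def)
  next
    case 2
    have "(\<Sum>e<d. plat_vr d mu b e a * plat_vr d mu b' e a')
        = (\<Sum>e<d. if b = e \<and> (b' = d \<and> a' = Suc b) then sqrt (mu e) else 0)"
      using 2 a by (intro sum.cong) (auto simp: plat_vr_def)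
    then show ?thesis unfolding R using 2 by (subst (asm) sum_delta_conj) (auto simp: p_def q_def tq)
  next
    case 3
    have "(\<Sum>e<d. plat_vr d mu b e a * plat_vr d mu b' e a')
        = (\<Sum>e<d. if b' = e \<and> (b = d \<and> a = Suc b') then sqrt (mu e) else 0)"
      using 3 a by (intro sum.cong) (auto simp: plat_vr_def)
    then show ?thesis unfolding R using 3
      by (subst (asm) sum_delta_conj) (auto simp: p_def q_def tq mult.commute)
  next
    case 4
    then obtain c c' where c: "a = Suc c" "a' = Suc c'" using not0_implies_Suc by blast
    have "(\<Sum>e<d. plat_vr d mu b e a * plat_vr d mu b' e a')
        = (\<Sum>e<d. if c = e \<and> (c = c' \<and> b = d \<and> b' = d) then 1 else 0)"
      using a by (intro sum.cong) (auto simp: plat_vr_def c)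
    also have "\<dots> = (if c = c' \<and> b = d \<and> b' = d then 1 else 0)"
      unfolding sum_delta_conj using a c by auto
    finally show ?thesis unfolding R using a b by (auto simp: c p_def q_def)
  qed
qed

lemma plat_isometry_single:
  assumes mu: "\<And>i. i < d \<Longrightarrow> mu i \<ge> 0" "(\<Sum>i<d. mu i) = 1" and a: "a \<le> d" "a' \<le> d"
  shows "(\<Sum>b<d + 1. \<Sum>e<d. plat_vr d mu b e a * plat_vr d mu b e a') = (if a = a' then 1 else 0)"
proof -
  consider "a = 0" "a' = 0" | "a \<noteq> 0" "a = a'" | "a \<noteq> a'" by blast
  then show ?thesis
  proof cases
    case 1
    have "(\<Sum>b<d + 1. \<Sum>e<d. plat_vr d mu b e a * plat_vr d mu b e a')
        = (\<Sum>b<d + 1. \<Sum>e<d. if b = e \<and> True then mu e else 0)"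
      using 1 by (intro sum.cong) (auto simp: plat_vr_def mu)
    also have "\<dots> = 1" unfolding sum_delta_conj using mu(2) by simp
    finally show ?thesis using 1 by simp
  next
    case 2
    have "(\<Sum>b<d + 1. \<Sum>e<d. plat_vr d mu b e a * plat_vr d mu b e a')
        = (\<Sum>b<d + 1. \<Sum>e<d. if e = a - 1 \<and> b = d then 1 else 0)"
      using 2 a by (intro sum.cong) (auto simp: plat_vr_def)
    also have "\<dots> = 1" unfolding sum_delta_conj using 2 a by simp
    finally show ?thesis using 2 by simp
  next
    case 3
    then show ?thesis using a by (auto simp: plat_vr_def intro!: sum.neutral)
  qed
qed

text \<open>The diagonal of the unsigned sum's input marginal. The 1 is the weight of the diagonal
  part, for input 0 the sum of all \<open>mu\<close>; the other term comes from the two vectors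
  carrying the signs.\<close>

definition plat_c :: "(nat \<Rightarrow> real) \<Rightarrow> real \<Rightarrow> nat \<Rightarrow> real" where
  "plat_c mu t a = (if a = 0 then 1 + t else 1 + mu (a - 1) / t)"

lemma plat_f_orthogonal_single:
  assumes mu: "\<And>i. i < d \<Longrightarrow> mu i \<ge> 0" "(\<Sum>i<d. mu i) = 1" and t: "t > 0"
    and a: "a \<le> d" "a' \<le> d"
  shows "(\<Sum>s<2 * d + 2. \<Sum>b<d + 1. plat_f d mu t s a b * plat_f d mu t s a' b)
    = (if a = a' then plat_c mu t a else 0)"
proof -
  define p where "p a b = (if a = 0 \<and> b = d then sqrt t else 0)" for a b :: nat
  define q where "q a b = (if a = Suc b \<and> b < d then sqrt (mu b / t) else 0)" for a b
  have 1: "(\<Sum>s<d. \<Sum>b<d + 1. plat_f d mu t s a b * plat_f d mu t s a' b)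
      = (if a = 0 \<and> a' = 0 then 1 else 0)"
  proof -
    have "(\<Sum>s<d. \<Sum>b<d + 1. plat_f d mu t s a b * plat_f d mu t s a' b)
      = (\<Sum>s<d. \<Sum>b<d + 1. if s = b \<and> a = 0 \<and> a' = 0 then mu b else 0)"
      by (intro sum.cong) (auto simp: plat_f_simps mu)
    then show ?thesis unfolding sum_delta_conj using mu(2) by simp
  qed
  have 2: "(\<Sum>s<d. \<Sum>b<d + 1. plat_f d mu t (d + s) a b * plat_f d mu t (d + s) a' b)
      = (if a = a' \<and> a \<noteq> 0 then 1 else 0)"
  proof -
    have "(\<Sum>s<d. \<Sum>b<d + 1. plat_f d mu t (d + s) a b * plat_f d mu t (d + s) a' b)
      = (\<Sum>s<d. \<Sum>b<d + 1. if b = d \<and> a = Suc s \<and> a' = Suc s then 1 else 0)"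
      by (intro sum.cong) (auto simp: plat_f_simps)
    also have "\<dots> = (\<Sum>s<d. if s = a - 1 \<and> a = a' \<and> a \<noteq> 0 then 1 else 0)"
      by (rule sum.cong[OF refl], subst sum_delta_conj) auto
    finally show ?thesis unfolding sum_delta_conj using a by auto
  qed
  \<comment> \<open>Without the sign, the half-sum replaces the half-difference: now the cross terms
    cancel and the squares remain, which makes the marginal diagonal.\<close>
  have 3: "(\<Sum>b<d + 1. plat_f d mu t (2 * d) a b * plat_f d mu t (2 * d) a' b)
      + (\<Sum>b<d + 1. plat_f d mu t (2 * d + 1) a b * plat_f d mu t (2 * d + 1) a' b)
      = (\<Sum>b<d + 1. p a b * p a' b) + (\<Sum>b<d + 1. q a b * q a' b)"
    unfolding plat_f_simps(3,4) p_def[symmetric] q_def[symmetric] sum.distrib[symmetric]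
    by (rule sum.cong)
      (simp_all add: algebra_simps add_divide_distrib[symmetric] diff_divide_distrib[symmetric])
  have 4: "(\<Sum>b<d + 1. p a b * p a' b) = (if a = 0 \<and> a' = 0 then t else 0)"
  proof -
    have "(\<Sum>b<d + 1. p a b * p a' b) = (\<Sum>b<d + 1. if b = d \<and> a = 0 \<and> a' = 0 then t else 0)"
      using t by (intro sum.cong) (auto simp: p_def)
    then show ?thesis unfolding sum_delta_conj by simp
  qed
  have 5: "(\<Sum>b<d + 1. q a b * q a' b) = (if a = a' \<and> a \<noteq> 0 then mu (a - 1) / t else 0)"
  proof (cases a)
    case (Suc c)
    have "(\<Sum>b<d + 1. q a b * q a' b)
        = (\<Sum>b<d + 1. if b = c \<and> a' = Suc c then mu b / t else 0)"
      using t a mu(1) by (intro sum.cong) (auto simp: q_def Suc)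
    also have "\<dots> = (if a' = Suc c then mu c / t else 0)"
      unfolding sum_delta_conj using a Suc by auto
    finally show ?thesis by (auto simp: Suc)
  qed (simp add: q_def)
  show ?thesis
    unfolding sum_plat_index add.assoc 1 2 3 4 5 by (auto simp: plat_c_def)
qed

section \<open>Tensor powers of the single-copy identities\<close>

definition plat_vn :: "nat \<Rightarrow> (nat \<Rightarrow> real) \<Rightarrow> nat \<Rightarrow> nat \<Rightarrow> nat \<Rightarrow> nat \<Rightarrow> real" where
  "plat_vn d mu n b e a = (\<Prod>k<n. plat_vr d mu (dig (d+1) b k) (dig d e k) (dig (d+1) a k))"

definition plat_fn :: "nat \<Rightarrow> (nat \<Rightarrow> real) \<Rightarrow> real \<Rightarrow> nat \<Rightarrow> nat \<Rightarrow> nat \<Rightarrow> nat \<Rightarrow> real" where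
  "plat_fn d mu t n s a b = (\<Prod>k<n. plat_f d mu t (dig (2*d+2) s k) (dig (d+1) a k) (dig (d+1) b k))"

definition plat_epsn :: "nat \<Rightarrow> nat \<Rightarrow> nat \<Rightarrow> real" where
  "plat_epsn d n s = (\<Prod>k<n. plat_eps d (dig (2*d+2) s k))"

definition plat_cn :: "nat \<Rightarrow> (nat \<Rightarrow> real) \<Rightarrow> real \<Rightarrow> nat \<Rightarrow> nat \<Rightarrow> real" where
  "plat_cn d mu t n a = (\<Prod>k<n. plat_c mu t (dig (d+1) a k))"

lemma platypus_Vn_real: "platypus_Vn d mu n b e a = complex_of_real (plat_vn d mu n b e a)"
  by (simp add: platypus_Vn_def plat_vn_def platypus_V_real)

lemma abs_plat_epsn: "\<bar>plat_epsn d n s\<bar> \<le> 1"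
  unfolding plat_epsn_def by (induction n) (auto simp: plat_eps_def abs_mult)

lemma dig_le: "dig (d + 1) x k \<le> d"
  using dig_less[of "d + 1" x k] by simp

lemma sum2_prod_dig:
  fixes h :: "nat \<Rightarrow> nat \<Rightarrow> nat \<Rightarrow> 'a::comm_semiring_1"
  assumes "p > 0" "q > 0"
  shows "(\<Sum>x<p ^ n. \<Sum>y<q ^ n. \<Prod>k<n. h k (dig p x k) (dig q y k))
    = (\<Prod>k<n. \<Sum>x<p. \<Sum>y<q. h k x y)"
  by (simp add: sum_prod_dig[OF assms(2), of "\<lambda>k. h k (dig p _ k)"]
      sum_prod_dig[OF assms(1), of "\<lambda>k x. \<Sum>y<q. h k x y"])

context
  fixes d :: nat and mu :: "nat \<Rightarrow> real"
  assumes d: "d \<ge> 1" and mu_nonneg: "\<forall>i<d. mu i \<ge> 0" and mu_sum: "(\<Sum>i<d. mu i) = 1"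
begin

text \<open>All indices enter through their digits, and a digit in base \<open>d + 1\<close> is
  always at most \<open>d\<close>, so no range conditions appear. The two statements that follow
  conclude equality of indices and therefore need them.\<close>

lemma plat_transpose:
  assumes t: "t > 0"
  shows "(\<Sum>e<d ^ n. plat_vn d mu n b e a * plat_vn d mu n b' e a')
    = (\<Sum>s<(2*d+2) ^ n. plat_epsn d n s * (plat_fn d mu t n s a b' * plat_fn d mu t n s a' b))"
proof -
  let ?D = "\<lambda>x k. dig (d + 1) x k"
  have "(\<Sum>e<d ^ n. plat_vn d mu n b e a * plat_vn d mu n b' e a')
      = (\<Prod>k<n. \<Sum>e<d. plat_vr d mu (?D b k) e (?D a k) * plat_vr d mu (?D b' k) e (?D a' k))"
    unfolding plat_vn_def prod.distrib[symmetric]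
    using d by (intro sum_prod_dig[of d "\<lambda>k e. plat_vr d mu (?D b k) e (?D a k) * plat_vr d mu (?D b' k) e (?D a' k)"]) simp
  also have "\<dots> = (\<Prod>k<n. \<Sum>s<2*d+2. plat_eps d s * (plat_f d mu t s (?D a k) (?D b' k) * plat_f d mu t s (?D a' k) (?D b k)))"
    by (intro prod.cong refl plat_transpose_single mu_nonneg[rule_format] t dig_le)
  also have "\<dots> = (\<Sum>s<(2*d+2) ^ n. plat_epsn d n s * (plat_fn d mu t n s a b' * plat_fn d mu t n s a' b))"
    unfolding plat_epsn_def plat_fn_def prod.distrib[symmetric]
    by (rule sum_prod_dig[of "2*d+2" "\<lambda>k s. plat_eps d s * (plat_f d mu t s (?D a k) (?D b' k) * plat_f d mu t s (?D a' k) (?D b k))", symmetric]) simp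
  finally show ?thesis .
qed

lemma plat_isometry:
  assumes "a < (d+1) ^ n" "a' < (d+1) ^ n"
  shows "(\<Sum>b<(d+1) ^ n. \<Sum>e<d ^ n. plat_vn d mu n b e a * plat_vn d mu n b e a') = (if a = a' then 1 else 0)"
proof -
  let ?D = "\<lambda>x k. dig (d + 1) x k"
  have "(\<Sum>b<(d+1) ^ n. \<Sum>e<d ^ n. plat_vn d mu n b e a * plat_vn d mu n b e a')
      = (\<Prod>k<n. \<Sum>b<d+1. \<Sum>e<d. plat_vr d mu b e (?D a k) * plat_vr d mu b e (?D a' k))"
    unfolding plat_vn_def prod.distrib[symmetric]
    using d by (intro sum2_prod_dig[of "d+1" d "\<lambda>k b e. plat_vr d mu b e (?D a k) * plat_vr d mu b e (?D a' k)"]) auto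
  also have "\<dots> = (\<Prod>k<n. if ?D a k = ?D a' k then 1 else 0)"
    by (intro prod.cong refl plat_isometry_single mu_nonneg[rule_format] mu_sum dig_le)
  also have "\<dots> = (if a = a' then 1 else 0)"
    using prod_dig_delta[OF assms, of "\<lambda>_. 1 :: real"] by simp
  finally show ?thesis .
qed

lemma plat_f_orthogonal:
  assumes t: "t > 0" and "a < (d+1) ^ n" "a' < (d+1) ^ n"
  shows "(\<Sum>s<(2*d+2) ^ n. \<Sum>b<(d+1) ^ n. plat_fn d mu t n s a b * plat_fn d mu t n s a' b)
    = (if a = a' then plat_cn d mu t n a else 0)"
proof -
  let ?D = "\<lambda>x k. dig (d + 1) x k"
  have "(\<Sum>s<(2*d+2) ^ n. \<Sum>b<(d+1) ^ n. plat_fn d mu t n s a b * plat_fn d mu t n s a' b)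
      = (\<Prod>k<n. \<Sum>s<2*d+2. \<Sum>b<d+1. plat_f d mu t s (?D a k) b * plat_f d mu t s (?D a' k) b)"
    unfolding plat_fn_def prod.distrib[symmetric]
    by (intro sum2_prod_dig[of "2*d+2" "d+1" "\<lambda>k s b. plat_f d mu t s (?D a k) b * plat_f d mu t s (?D a' k) b"]) auto
  also have "\<dots> = (\<Prod>k<n. if ?D a k = ?D a' k then plat_c mu t (?D a k) else 0)"
    by (intro prod.cong refl plat_f_orthogonal_single mu_nonneg[rule_format] mu_sum t dig_le)
  also have "\<dots> = (if a = a' then plat_cn d mu t n a else 0)"
    unfolding plat_cn_def by (rule prod_dig_delta[OF assms(2,3)])
  finally show ?thesis .
qed

text \<open>Each factor is at most \<open>1 + t\<close>: with equality for digit 0, and for the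
  other digits because \<open>mu i\<close> at most \<open>t\<close> squared means
  \<open>mu i / t\<close> at most \<open>t\<close>.\<close>

lemma plat_cn_le:
  assumes t: "t > 0" "\<forall>i<d. mu i \<le> t\<^sup>2"
  shows "plat_cn d mu t n a \<le> (1 + t) ^ n"
proof -
  have "0 \<le> plat_c mu t x \<and> plat_c mu t x \<le> 1 + t" if "x \<le> d" for x
  proof (cases x)
    case (Suc i)
    then have "0 \<le> mu i" "mu i \<le> t * t" using that mu_nonneg t(2) by (auto simp: power2_eq_square)
    then show ?thesis using t(1) by (simp add: plat_c_def Suc pos_divide_le_eq)
  qed (use t in \<open>simp add: plat_c_def\<close>)
  then have "plat_cn d mu t n a \<le> (\<Prod>k<n. 1 + t)"
    unfolding plat_cn_def using dig_le by (intro prod_mono) auto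
  then show ?thesis by simp
qed

end

section \<open>States as Gram matrices and the bound for n uses\<close>

lemma density_op_trace: "density_op N \<rho> \<Longrightarrow> (\<Sum>i<N. \<rho> $$ (i, i)) = 1"
  unfolding density_op_def by blast

lemma density_op_carrier: "density_op N \<rho> \<Longrightarrow> \<rho> \<in> carrier_mat N N"
  unfolding density_op_def by blast

lemma density_op_eigsys:
  assumes "density_op N A"
  obtains u lam where "eigsys N (\<lambda>i j. A $$ (i, j)) u lam" "\<And>k. k < N \<Longrightarrow> lam k \<ge> 0" "(\<Sum>k<N. lam k) = 1"
proof -
  obtain u lam where u: "eigsys N (\<lambda>i j. A $$ (i, j)) u lam"
    by (rule spectral_hermitian[of N "\<lambda>i j. A $$ (i, j)"]) (use assms in \<open>unfold density_op_def, blast\<close>)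
  have "lam k \<ge> 0" if "k < N" for k
  proof -
    have "0 \<le> Re (\<Sum>i<N. \<Sum>j<N. cnj (u k i) * A $$ (i, j) * u k j)"
      using assms unfolding density_op_def by blast
    then show ?thesis unfolding eigsys_quadratic[OF u that] by simp
  qed
  moreover have "complex_of_real (\<Sum>k<N. lam k) = 1"
    unfolding eigsys_trace[OF u, symmetric] using assms by (rule density_op_trace)
  then have "(\<Sum>k<N. lam k) = 1" by (simp only: of_real_eq_1_iff)
  ultimately show ?thesis using u that by blast
qed

text \<open>A purification: \<open>L i l\<close> is the amplitude with reference index
  \<open>l\<close>, obtained by scaling each eigenvector by the square root of its
  eigenvalue.\<close>

lemma density_op_gram:
  assumes "density_op N \<rho>"
  obtains L where "\<And>i j. i < N \<Longrightarrow> j < N \<Longrightarrow> \<rho> $$ (i, j) = (\<Sum>l<N. L i l * cnj (L j l))"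
    "(\<Sum>l<N. \<Sum>i<N. (cmod (L i l))\<^sup>2) = 1"
proof -
  obtain u lam where u: "eigsys N (\<lambda>i j. \<rho> $$ (i, j)) u lam" and lam: "\<And>k. k < N \<Longrightarrow> lam k \<ge> 0"
    using density_op_eigsys[OF assms] by blast
  define L where "L i l = complex_of_real (sqrt (lam l)) * u l i" for i l
  have L: "L i l * cnj (L j l) = complex_of_real (lam l) * u l i * cnj (u l j)" if "l < N" for i j l
  proof -
    have "complex_of_real (sqrt (lam l)) * complex_of_real (sqrt (lam l)) = complex_of_real (lam l)"
      using lam[OF that] by (simp flip: of_real_mult)
    then show ?thesis by (simp add: L_def mult_ac)
  qed
  show ?thesis
  proof (rule that)
    show "\<rho> $$ (i, j) = (\<Sum>l<N. L i l * cnj (L j l))" if "i < N" "j < N" for i j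
      using eigsys_expand[OF u that] by (simp add: L)
    have "complex_of_real (\<Sum>l<N. \<Sum>i<N. (cmod (L i l))\<^sup>2) = (\<Sum>i<N. \<Sum>l<N. L i l * cnj (L i l))"
      by (subst sum.swap) (simp add: complex_norm_square del: of_real_power)
    also have "\<dots> = (\<Sum>i<N. \<rho> $$ (i, i))"
      by (intro sum.cong refl) (simp add: eigsys_expand[OF u] L)
    also have "\<dots> = 1" using assms by (rule density_op_trace)
    finally show "(\<Sum>l<N. \<Sum>i<N. (cmod (L i l))\<^sup>2) = 1" by (simp only: of_real_eq_1_iff)
  qed
qed

text \<open>Two families \<open>X\<close> and \<open>Y\<close> serve the channel and its complement
  alike: the summed index \<open>p\<close> is the environment in one case and the output in the
  other.\<close>

lemma kraus_gram:
  fixes X Y :: "nat \<Rightarrow> nat \<Rightarrow> complex"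
  assumes "\<And>a a'. a < N \<Longrightarrow> a' < N \<Longrightarrow> R a a' = (\<Sum>l<M. L a l * cnj (L a' l))"
  shows "(\<Sum>p<P. \<Sum>a<N. \<Sum>a'<N. X p a * R a a' * cnj (Y p a'))
    = (\<Sum>l<M. \<Sum>p<P. (\<Sum>a<N. X p a * L a l) * cnj (\<Sum>a<N. Y p a * L a l))"
proof -
  have "(\<Sum>p<P. \<Sum>a<N. \<Sum>a'<N. X p a * R a a' * cnj (Y p a'))
      = (\<Sum>p<P. \<Sum>a<N. \<Sum>a'<N. \<Sum>l<M. (X p a * L a l) * cnj (Y p a' * L a' l))"
    using assms by (intro sum.cong refl) (simp add: sum_distrib_left sum_distrib_right mult_ac)
  also have "\<dots> = (\<Sum>p<P. \<Sum>a<N. \<Sum>l<M. \<Sum>a'<N. (X p a * L a l) * cnj (Y p a' * L a' l))"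
    by (rule sum.cong[OF refl], rule sum.cong[OF refl], rule sum.swap)
  also have "\<dots> = (\<Sum>p<P. \<Sum>l<M. \<Sum>a<N. \<Sum>a'<N. (X p a * L a l) * cnj (Y p a' * L a' l))"
    by (rule sum.cong[OF refl], rule sum.swap)
  also have "\<dots> = (\<Sum>l<M. \<Sum>p<P. \<Sum>a<N. \<Sum>a'<N. (X p a * L a l) * cnj (Y p a' * L a' l))"
    by (rule sum.swap)
  also have "\<dots> = (\<Sum>l<M. \<Sum>p<P. (\<Sum>a<N. X p a * L a l) * cnj (\<Sum>a<N. Y p a * L a l))"
    unfolding cnj_sum sum_product ..
  finally show ?thesis .
qed

text \<open>Amplitudes of the purified input after the isometry has acted on it, indexed by
  reference, output and environment.\<close>

definition plat_T :: "nat \<Rightarrow> (nat \<Rightarrow> real) \<Rightarrow> nat \<Rightarrow> (nat \<Rightarrow> nat \<Rightarrow> complex) \<Rightarrow> nat \<Rightarrow> nat \<Rightarrow> nat \<Rightarrow> complex" where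
  "plat_T d mu n L l b e = (\<Sum>a<(d+1) ^ n. platypus_Vn d mu n b e a * L a l)"

lemma platypus_gram:
  assumes "\<And>a a'. a < (d+1) ^ n \<Longrightarrow> a' < (d+1) ^ n \<Longrightarrow> \<rho> $$ (a, a') = (\<Sum>l<M. L a l * cnj (L a' l))"
  shows "platypus_chan d mu n \<rho> = mat ((d+1) ^ n) ((d+1) ^ n)
      (\<lambda>(b, b'). \<Sum>l<M. \<Sum>e<d ^ n. plat_T d mu n L l b e * cnj (plat_T d mu n L l b' e))"
    and "platypus_compl d mu n \<rho> = mat (d ^ n) (d ^ n)
      (\<lambda>(e, e'). \<Sum>l<M. \<Sum>b<(d+1) ^ n. plat_T d mu n L l b e * cnj (plat_T d mu n L l b e'))"
proof -
  show "platypus_chan d mu n \<rho> = mat ((d+1) ^ n) ((d+1) ^ n)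
      (\<lambda>(b, b'). \<Sum>l<M. \<Sum>e<d ^ n. plat_T d mu n L l b e * cnj (plat_T d mu n L l b' e))"
    unfolding platypus_chan_def plat_T_def
  proof (intro cong_mat refl, unfold prod.case)
    fix b b'
    show "(\<Sum>e<d ^ n. \<Sum>a<(d+1) ^ n. \<Sum>a'<(d+1) ^ n.
        platypus_Vn d mu n b e a * \<rho> $$ (a, a') * cnj (platypus_Vn d mu n b' e a'))
      = (\<Sum>l<M. \<Sum>e<d ^ n. (\<Sum>a<(d+1) ^ n. platypus_Vn d mu n b e a * L a l) *
        cnj (\<Sum>a<(d+1) ^ n. platypus_Vn d mu n b' e a * L a l))"
      by (rule kraus_gram[where R = "\<lambda>a a'. \<rho> $$ (a, a')"]) (rule assms)
  qed
  show "platypus_compl d mu n \<rho> = mat (d ^ n) (d ^ n)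
      (\<lambda>(e, e'). \<Sum>l<M. \<Sum>b<(d+1) ^ n. plat_T d mu n L l b e * cnj (plat_T d mu n L l b e'))"
    unfolding platypus_compl_def plat_T_def
  proof (intro cong_mat refl, unfold prod.case)
    fix e e'
    show "(\<Sum>b<(d+1) ^ n. \<Sum>a<(d+1) ^ n. \<Sum>a'<(d+1) ^ n.
        platypus_Vn d mu n b e a * \<rho> $$ (a, a') * cnj (platypus_Vn d mu n b e' a'))
      = (\<Sum>l<M. \<Sum>b<(d+1) ^ n. (\<Sum>a<(d+1) ^ n. platypus_Vn d mu n b e a * L a l) *
        cnj (\<Sum>a<(d+1) ^ n. platypus_Vn d mu n b e' a * L a l))"
      by (rule kraus_gram[where R = "\<lambda>a a'. \<rho> $$ (a, a')" and X = "\<lambda>b. platypus_Vn d mu n b e"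
            and Y = "\<lambda>b. platypus_Vn d mu n b e'"]) (rule assms)
  qed
qed

lemma plat_T_norm:
  assumes d: "d \<ge> 1" and mu: "\<forall>i<d. mu i \<ge> 0" "(\<Sum>i<d. mu i) = 1"
    and L: "(\<Sum>l<M. \<Sum>i<(d+1) ^ n. (cmod (L i l))\<^sup>2) = 1"
  shows "(\<Sum>l<M. \<Sum>b<(d+1) ^ n. \<Sum>e<d ^ n. (cmod (plat_T d mu n L l b e))\<^sup>2) = 1"
proof -
  have "(\<Sum>b<(d+1) ^ n. \<Sum>e<d ^ n. (cmod (plat_T d mu n L l b e))\<^sup>2)
      = (\<Sum>a<(d+1) ^ n. 1 * (cmod (L a l))\<^sup>2)" for l
    unfolding plat_T_def
  proof (rule orthogonal_norm)
    fix i j assume "i < (d+1) ^ n" "j < (d+1) ^ n"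
    from plat_isometry[OF d mu this]
    have "complex_of_real (\<Sum>b<(d+1) ^ n. \<Sum>e<d ^ n. plat_vn d mu n b e i * plat_vn d mu n b e j)
        = complex_of_real (if i = j then 1 else 0)" by (simp only:)
    then show "(\<Sum>b<(d+1) ^ n. \<Sum>e<d ^ n. platypus_Vn d mu n b e i * cnj (platypus_Vn d mu n b e j))
        = (if i = j then complex_of_real 1 else 0)"
      by (simp add: platypus_Vn_real split: if_splits)
  qed
  then show ?thesis using L by simp
qed

lemma platypus_coherent_le:
  assumes d: "d \<ge> 1" and mu: "\<forall>i<d. mu i \<ge> 0" "(\<Sum>i<d. mu i) = 1"
    and t: "t > 0" "\<forall>i<d. mu i \<le> t\<^sup>2"
    and dens: "density_op ((d+1) ^ n) \<rho>"
  shows "vn_entropy (platypus_chan d mu n \<rho>) - vn_entropy (platypus_compl d mu n \<rho>)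
    \<le> real n * log 2 (1 + t)"
proof -
  let ?N = "(d+1) ^ n"
  obtain L where L: "\<And>i j. i < ?N \<Longrightarrow> j < ?N \<Longrightarrow> \<rho> $$ (i, j) = (\<Sum>l<?N. L i l * cnj (L j l))"
    and L1: "(\<Sum>l<?N. \<Sum>i<?N. (cmod (L i l))\<^sup>2) = 1"
    using density_op_gram[OF dens] by blast
  have gram: "platypus_chan d mu n \<rho> = mat ?N ?N
      (\<lambda>(b, b'). \<Sum>l<?N. \<Sum>e<d ^ n. plat_T d mu n L l b e * cnj (plat_T d mu n L l b' e))"
    "platypus_compl d mu n \<rho> = mat (d ^ n) (d ^ n)
      (\<lambda>(e, e'). \<Sum>l<?N. \<Sum>b<?N. plat_T d mu n L l b e * cnj (plat_T d mu n L l b e'))"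
    by (rule platypus_gram, rule L, assumption+)+
  \<comment> \<open>The vectors of the signed decomposition, with the purification applied to their
    input index.\<close>
  define F where "F s l b = (\<Sum>a<?N. complex_of_real (plat_fn d mu t n s a b) * L a l)" for s l b
  define W where "W = (\<Sum>s<(2*d+2) ^ n. \<Sum>l<?N. \<Sum>b<?N. (cmod (F s l b))\<^sup>2)"
  have "vn_entropy (platypus_chan d mu n \<rho>) - vn_entropy (platypus_compl d mu n \<rho>) \<le> log 2 W"
    unfolding gram W_def
  proof (rule coherent_information_bound)
    show "\<bar>plat_epsn d n s\<bar> \<le> 1" for s by (rule abs_plat_epsn)
    show "(\<Sum>l<?N. \<Sum>b<?N. \<Sum>e<d ^ n. (cmod (plat_T d mu n L l b e))\<^sup>2) = 1"
      by (rule plat_T_norm[OF d mu L1])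
    fix l l' b b'
    have "(\<Sum>e<d ^ n. plat_T d mu n L l b e * cnj (plat_T d mu n L l' b' e))
        = (\<Sum>e<d ^ n. \<Sum>a<?N. \<Sum>a'<?N. (L a l * cnj (L a' l')) *
            complex_of_real (plat_vn d mu n b e a * plat_vn d mu n b' e a'))"
      unfolding plat_T_def cnj_sum sum_product by (simp add: platypus_Vn_real mult_ac)
    also have "\<dots> = (\<Sum>a<?N. \<Sum>a'<?N. (L a l * cnj (L a' l')) *
            complex_of_real (\<Sum>e<d ^ n. plat_vn d mu n b e a * plat_vn d mu n b' e a'))"
      unfolding of_real_sum sum_distrib_left
      by (subst sum.swap, rule sum.cong[OF refl], rule sum.swap)
    also have "\<dots> = (\<Sum>a<?N. \<Sum>a'<?N. \<Sum>s<(2*d+2) ^ n. (L a l * cnj (L a' l')) *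
            complex_of_real (plat_epsn d n s * (plat_fn d mu t n s a b' * plat_fn d mu t n s a' b)))"
      unfolding plat_transpose[OF d mu t(1)] unfolding of_real_sum sum_distrib_left ..
    also have "\<dots> = (\<Sum>a<?N. \<Sum>s<(2*d+2) ^ n. \<Sum>a'<?N. (L a l * cnj (L a' l')) *
            complex_of_real (plat_epsn d n s * (plat_fn d mu t n s a b' * plat_fn d mu t n s a' b)))"
      by (rule sum.cong[OF refl], rule sum.swap)
    also have "\<dots> = (\<Sum>s<(2*d+2) ^ n. \<Sum>a<?N. \<Sum>a'<?N. (L a l * cnj (L a' l')) *
            complex_of_real (plat_epsn d n s * (plat_fn d mu t n s a b' * plat_fn d mu t n s a' b)))"
      by (rule sum.swap)
    also have "\<dots> = (\<Sum>s<(2*d+2) ^ n. complex_of_real (plat_epsn d n s) * (F s l b' * cnj (F s l' b)))"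
      unfolding F_def cnj_sum sum_product
      unfolding sum_distrib_left by (simp add: mult_ac)
    finally show "(\<Sum>e<d ^ n. plat_T d mu n L l b e * cnj (plat_T d mu n L l' b' e))
        = (\<Sum>s<(2*d+2) ^ n. complex_of_real (plat_epsn d n s) * (F s l b' * cnj (F s l' b)))" .
  qed
  also have "log 2 W \<le> real n * log 2 (1 + t)"
  proof (cases "W > 0")
    case True
    \<comment> \<open>Orthogonality over inputs turns \<open>W\<close> into an average of
      \<open>plat_cn\<close>, weighted by the diagonal of the input state.\<close>
    have "W = (\<Sum>l<?N. \<Sum>s<(2*d+2) ^ n. \<Sum>b<?N. (cmod (F s l b))\<^sup>2)"
      unfolding W_def by (rule sum.swap)
    also have "\<dots> = (\<Sum>l<?N. \<Sum>a<?N. plat_cn d mu t n a * (cmod (L a l))\<^sup>2)"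
      unfolding F_def
    proof (rule sum.cong[OF refl], rule orthogonal_norm)
      fix i j assume "i < ?N" "j < ?N"
      from plat_f_orthogonal[OF d mu t(1) this]
      have "complex_of_real (\<Sum>s<(2*d+2) ^ n. \<Sum>b<?N. plat_fn d mu t n s i b * plat_fn d mu t n s j b)
          = complex_of_real (if i = j then plat_cn d mu t n i else 0)" by (simp only:)
      then show "(\<Sum>s<(2*d+2) ^ n. \<Sum>b<?N. complex_of_real (plat_fn d mu t n s i b) *
            cnj (complex_of_real (plat_fn d mu t n s j b)))
          = (if i = j then complex_of_real (plat_cn d mu t n i) else 0)"
        by (simp split: if_splits)
    qed
    also have "\<dots> \<le> (\<Sum>l<?N. \<Sum>a<?N. (1 + t) ^ n * (cmod (L a l))\<^sup>2)"
      by (intro sum_mono mult_right_mono plat_cn_le[OF d mu t]) auto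
    also have "\<dots> = (1 + t) ^ n"
      using L1 by (simp add: sum_distrib_left[symmetric])
    finally have "log 2 W \<le> log 2 ((1 + t) ^ n)" using True by simp
    then show ?thesis using t by (simp add: log_nat_power)
  next
    \<comment> \<open>Here \<open>log 2 0\<close> takes the value 0 because \<open>ln 0 = 0\<close>
      in HOL, and the right side is nonnegative.\<close>
    case False
    moreover have "W \<ge> 0" by (simp add: W_def sum_nonneg)
    ultimately have "W = 0" by simp
    then show ?thesis using t by (simp add: log_def)
  qed
  finally show ?thesis .
qed

lemma density_op_of_gram:
  fixes G :: "nat \<Rightarrow> nat \<Rightarrow> nat \<Rightarrow> complex"
  assumes A: "A \<in> carrier_mat N N"
    and G: "\<And>i j. i < N \<Longrightarrow> j < N \<Longrightarrow> A $$ (i, j) = (\<Sum>p<P. \<Sum>q<Q. G p q i * cnj (G p q j))"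
    and tr: "(\<Sum>i<N. A $$ (i, i)) = 1"
  shows "density_op N A"
  unfolding density_op_def
proof (intro conjI allI impI A tr)
  show "A $$ (i, j) = cnj (A $$ (j, i))" if "i < N" "j < N" for i j
    using that by (simp add: G mult.commute)
  fix v :: "nat \<Rightarrow> complex"
  have "(\<Sum>i<N. \<Sum>j<N. cnj (v i) * A $$ (i, j) * v j)
      = (\<Sum>i<N. \<Sum>j<N. cnj (v i) * (\<Sum>p<P. \<Sum>q<Q. G p q i * cnj (G p q j)) * v j)"
    by (intro sum.cong refl) (simp add: G)
  also have "\<dots> = complex_of_real (\<Sum>p<P. \<Sum>q<Q. (cmod (\<Sum>i<N. cnj (v i) * G p q i))\<^sup>2)"
    by (rule gram_quadratic)
  finally show "0 \<le> Re (\<Sum>i<N. \<Sum>j<N. cnj (v i) * A $$ (i, j) * v j)"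
    by (simp only: Re_complex_of_real) (intro sum_nonneg zero_le_power2)
qed

subsection \<open>Tensor products\<close>

text \<open>The first factor sits in the low part of the index, in agreement with \<open>dig\<close>
  counting from the least significant digit: a block of \<open>m\<close> copies followed by
  \<open>n\<close> copies splits by \<open>mod\<close> and \<open>div\<close>.\<close>

definition tens :: "nat \<Rightarrow> nat \<Rightarrow> complex mat \<Rightarrow> complex mat \<Rightarrow> complex mat" where
  "tens M N A B = mat (M * N) (M * N)
    (\<lambda>(i, j). A $$ (i mod M, j mod M) * B $$ (i div M, j div M))"

lemma sum_mod_div_mult:
  fixes g h :: "nat \<Rightarrow> 'a::comm_semiring_0"
  assumes "M > 0"
  shows "(\<Sum>x<M * N. g (x mod M) * h (x div M)) = (\<Sum>i<M. g i) * (\<Sum>j<N. h j)"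
  by (simp add: sum_mod_div[OF assms, of "\<lambda>i j. g i * h j"] sum_product)

lemma div_less_mult: "x < M * N \<Longrightarrow> x div M < N" for x M N :: nat
  by (simp add: less_mult_imp_div_less mult.commute)

lemma density_op_tens:
  assumes M: "M > 0" and A: "density_op M A" and B: "density_op N B"
  shows "density_op (M * N) (tens M N A B)"
proof -
  obtain K where K: "\<And>i j. i < M \<Longrightarrow> j < M \<Longrightarrow> A $$ (i, j) = (\<Sum>l<M. K i l * cnj (K j l))"
    using density_op_gram[OF A] by blast
  obtain L where L: "\<And>i j. i < N \<Longrightarrow> j < N \<Longrightarrow> B $$ (i, j) = (\<Sum>l<N. L i l * cnj (L j l))"
    using density_op_gram[OF B] by blast
  show ?thesis
  proof (rule density_op_of_gram[where G = "\<lambda>p q i. K (i mod M) p * L (i div M) q"])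
    show "tens M N A B \<in> carrier_mat (M * N) (M * N)" by (simp add: tens_def)
    show "tens M N A B $$ (i, j) = (\<Sum>p<M. \<Sum>q<N. K (i mod M) p * L (i div M) q *
        cnj (K (j mod M) p * L (j div M) q))" if "i < M * N" "j < M * N" for i j
      using that M by (simp add: tens_def K L div_less_mult sum_product mult_ac)
    have "(\<Sum>i<M * N. tens M N A B $$ (i, i))
        = (\<Sum>i<M * N. A $$ (i mod M, i mod M) * B $$ (i div M, i div M))"
      by (simp add: tens_def)
    also have "\<dots> = 1"
      using A B by (simp add: sum_mod_div_mult[OF M, of "\<lambda>i. A $$ (i, i)" "\<lambda>i. B $$ (i, i)"] density_op_trace)
    finally show "(\<Sum>i<M * N. tens M N A B $$ (i, i)) = 1" .
  qed
qed

lemma eta_mult: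
  assumes "x \<ge> 0" "y \<ge> 0" shows "eta (x * y) = eta x * y + x * eta y"
  using assms by (auto simp: eta_def log_mult algebra_simps mult_le_0_iff)

text \<open>Products of eigenvectors form an eigensystem with the products of the eigenvalues. By
  \<open>eta_mult\<close> the sum of \<open>eta\<close> splits, each part keeping a factor that is
  the trace of the other state, namely 1.\<close>

lemma vn_entropy_tens:
  assumes M: "M > 0" and A: "density_op M A" and B: "density_op N B"
  shows "vn_entropy (tens M N A B) = vn_entropy A + vn_entropy B"
proof -
  obtain u lam where u: "eigsys M (\<lambda>i j. A $$ (i, j)) u lam"
    and lam: "\<And>k. k < M \<Longrightarrow> lam k \<ge> 0" "(\<Sum>k<M. lam k) = 1"
    using density_op_eigsys[OF A] by blast
  obtain v bet where v: "eigsys N (\<lambda>i j. B $$ (i, j)) v bet"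
    and bet: "\<And>k. k < N \<Longrightarrow> bet k \<ge> 0" "(\<Sum>k<N. bet k) = 1"
    using density_op_eigsys[OF B] by blast
  have A_eq: "mat M M (($$) A) = A" and B_eq: "mat N N (($$) B) = B"
    using density_op_carrier[OF A] density_op_carrier[OF B] by (auto intro!: eq_matI)
  define w where "w k i = u (k mod M) (i mod M) * v (k div M) (i div M)" for k i
  define ev where "ev k = lam (k mod M) * bet (k div M)" for k
  have "eigsys (M * N) (\<lambda>i j. A $$ (i mod M, j mod M) * B $$ (i div M, j div M)) w ev"
    unfolding eigsys_def onb_def
  proof (intro conjI allI impI)
    fix k l assume kl: "k < M * N" "l < M * N"
    have "(\<Sum>i<M * N. w k i * cnj (w l i))
        = (\<Sum>i<M * N. (u (k mod M) (i mod M) * cnj (u (l mod M) (i mod M))) *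
            (v (k div M) (i div M) * cnj (v (l div M) (i div M))))"
      by (simp add: w_def mult_ac)
    also have "\<dots> = (\<Sum>i<M. u (k mod M) i * cnj (u (l mod M) i)) * (\<Sum>i<N. v (k div M) i * cnj (v (l div M) i))"
      by (rule sum_mod_div_mult[OF M])
    also have "\<dots> = of_bool (k mod M = l mod M) * of_bool (k div M = l div M)"
      using u v M kl by (simp add: eigsys_def onb_def div_less_mult)
    also have "\<dots> = of_bool (k = l)"
    proof -
      have "k = l \<longleftrightarrow> k mod M = l mod M \<and> k div M = l div M" by (metis div_mult_mod_eq)
      then show ?thesis by (simp only: of_bool_conj)
    qed
    finally show "(\<Sum>i<M * N. w k i * cnj (w l i)) = of_bool (k = l)" .
  next
    fix k i assume ki: "k < M * N" "i < M * N"
    have "(\<Sum>j<M * N. A $$ (i mod M, j mod M) * B $$ (i div M, j div M) * w k j)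
        = (\<Sum>j<M * N. (A $$ (i mod M, j mod M) * u (k mod M) (j mod M)) *
            (B $$ (i div M, j div M) * v (k div M) (j div M)))"
      by (simp add: w_def mult_ac)
    also have "\<dots> = (\<Sum>j<M. A $$ (i mod M, j) * u (k mod M) j) * (\<Sum>j<N. B $$ (i div M, j) * v (k div M) j)"
      by (rule sum_mod_div_mult[OF M])
    also have "\<dots> = complex_of_real (ev k) * w k i"
      using u v M ki by (simp add: eigsys_def div_less_mult ev_def w_def)
    finally show "(\<Sum>j<M * N. A $$ (i mod M, j mod M) * B $$ (i div M, j div M) * w k j)
        = complex_of_real (ev k) * w k i" .
  qed
  from vn_entropy_eigsys[OF this]
  have "vn_entropy (tens M N A B) = - (\<Sum>k<M * N. eta (ev k))" by (simp add: tens_def)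
  also have "(\<Sum>k<M * N. eta (ev k)) = (\<Sum>i<M. \<Sum>j<N. eta (lam i * bet j))"
    unfolding ev_def by (rule sum_mod_div[OF M])
  also have "\<dots> = (\<Sum>i<M. \<Sum>j<N. eta (lam i) * bet j + lam i * eta (bet j))"
    by (intro sum.cong refl eta_mult lam bet) auto
  also have "\<dots> = (\<Sum>i<M. eta (lam i)) + (\<Sum>j<N. eta (bet j))"
    by (simp add: sum.distrib sum_product[symmetric] lam bet)
  finally show ?thesis
    using vn_entropy_eigsys[OF u] vn_entropy_eigsys[OF v] by (simp add: A_eq B_eq)
qed

lemma prod_lessThan_add:
  fixes h :: "nat \<Rightarrow> 'a::comm_monoid_mult"
  shows "(\<Prod>i<m + n. h i) = (\<Prod>i<m. h i) * (\<Prod>i<n. h (m + i))"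
  by (induction n) (simp_all add: mult.assoc)

lemma platypus_Vn_add:
  "platypus_Vn d mu (m + n) b e a =
    platypus_Vn d mu m (b mod (d+1) ^ m) (e mod d ^ m) (a mod (d+1) ^ m) *
    platypus_Vn d mu n (b div (d+1) ^ m) (e div d ^ m) (a div (d+1) ^ m)"
  unfolding platypus_Vn_def prod_lessThan_add dig_div
  by (intro arg_cong2[of _ _ _ _ "(*)"] prod.cong refl) (simp add: dig_mod)

lemma sum3_mod_div_mult:
  fixes g h :: "nat \<Rightarrow> nat \<Rightarrow> nat \<Rightarrow> 'a::comm_semiring_0"
  assumes "E > 0" "A > 0"
  shows "(\<Sum>e<E * E'. \<Sum>a<A * A'. \<Sum>b<A * A'. g (e mod E) (a mod A) (b mod A) * h (e div E) (a div A) (b div A))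
    = (\<Sum>e<E. \<Sum>a<A. \<Sum>b<A. g e a b) * (\<Sum>e<E'. \<Sum>a<A'. \<Sum>b<A'. h e a b)"
  unfolding sum_mod_div_mult[OF assms(2), of "g _ _" "h _ _"]
    sum_mod_div_mult[OF assms(2), of "\<lambda>a. sum (g _ a) {..<A}" "\<lambda>a. sum (h _ a) {..<A'}"]
  by (rule sum_mod_div_mult[OF assms(1)])

text \<open>Together with its counterpart for the complement, this makes coherent information
  additive on product inputs, which yields superadditivity of \<open>platypus_Q1\<close>.\<close>

lemma platypus_chan_tens:
  assumes d: "d \<ge> 1"
  shows "platypus_chan d mu (m + n) (tens ((d+1) ^ m) ((d+1) ^ n) \<rho> \<sigma>)
    = tens ((d+1) ^ m) ((d+1) ^ n) (platypus_chan d mu m \<rho>) (platypus_chan d mu n \<sigma>)"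
proof (rule eq_matI)
  let ?M = "(d+1) ^ m" and ?N = "(d+1) ^ n"
  fix b b'
  assume "b < dim_row (tens ?M ?N (platypus_chan d mu m \<rho>) (platypus_chan d mu n \<sigma>))"
    and "b' < dim_col (tens ?M ?N (platypus_chan d mu m \<rho>) (platypus_chan d mu n \<sigma>))"
  then have b: "b < ?M * ?N" "b' < ?M * ?N" by (simp_all add: tens_def)
  let ?g = "\<lambda>e a a'. platypus_Vn d mu m (b mod ?M) e a * \<rho> $$ (a, a') * cnj (platypus_Vn d mu m (b' mod ?M) e a')"
  let ?h = "\<lambda>e a a'. platypus_Vn d mu n (b div ?M) e a * \<sigma> $$ (a, a') * cnj (platypus_Vn d mu n (b' div ?M) e a')"
  have "platypus_chan d mu (m + n) (tens ?M ?N \<rho> \<sigma>) $$ (b, b')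
      = (\<Sum>e<d ^ m * d ^ n. \<Sum>a<?M * ?N. \<Sum>a'<?M * ?N.
          ?g (e mod d ^ m) (a mod ?M) (a' mod ?M) * ?h (e div d ^ m) (a div ?M) (a' div ?M))"
    using b unfolding platypus_chan_def power_add
    by (auto simp: tens_def platypus_Vn_add mult_ac intro!: sum.cong)
  also have "\<dots> = (\<Sum>e<d ^ m. \<Sum>a<?M. \<Sum>a'<?M. ?g e a a') * (\<Sum>e<d ^ n. \<Sum>a<?N. \<Sum>a'<?N. ?h e a a')"
    using d by (intro sum3_mod_div_mult) auto
  also have "\<dots> = tens ?M ?N (platypus_chan d mu m \<rho>) (platypus_chan d mu n \<sigma>) $$ (b, b')"
    using b by (simp add: tens_def platypus_chan_def div_less_mult)
  finally show "platypus_chan d mu (m + n) (tens ?M ?N \<rho> \<sigma>) $$ (b, b')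
      = tens ?M ?N (platypus_chan d mu m \<rho>) (platypus_chan d mu n \<sigma>) $$ (b, b')" .
qed (simp_all add: platypus_chan_def tens_def power_add)

lemma platypus_compl_tens:
  assumes d: "d \<ge> 1"
  shows "platypus_compl d mu (m + n) (tens ((d+1) ^ m) ((d+1) ^ n) \<rho> \<sigma>)
    = tens (d ^ m) (d ^ n) (platypus_compl d mu m \<rho>) (platypus_compl d mu n \<sigma>)"
proof (rule eq_matI)
  let ?M = "(d+1) ^ m" and ?N = "(d+1) ^ n"
  fix e e'
  assume "e < dim_row (tens (d ^ m) (d ^ n) (platypus_compl d mu m \<rho>) (platypus_compl d mu n \<sigma>))"
    and "e' < dim_col (tens (d ^ m) (d ^ n) (platypus_compl d mu m \<rho>) (platypus_compl d mu n \<sigma>))"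
  then have e: "e < d ^ m * d ^ n" "e' < d ^ m * d ^ n" by (simp_all add: tens_def)
  let ?g = "\<lambda>b a a'. platypus_Vn d mu m b (e mod d ^ m) a * \<rho> $$ (a, a') * cnj (platypus_Vn d mu m b (e' mod d ^ m) a')"
  let ?h = "\<lambda>b a a'. platypus_Vn d mu n b (e div d ^ m) a * \<sigma> $$ (a, a') * cnj (platypus_Vn d mu n b (e' div d ^ m) a')"
  have "platypus_compl d mu (m + n) (tens ?M ?N \<rho> \<sigma>) $$ (e, e')
      = (\<Sum>b<?M * ?N. \<Sum>a<?M * ?N. \<Sum>a'<?M * ?N.
          ?g (b mod ?M) (a mod ?M) (a' mod ?M) * ?h (b div ?M) (a div ?M) (a' div ?M))"
    using e unfolding platypus_compl_def power_add
    by (auto simp: tens_def platypus_Vn_add mult_ac intro!: sum.cong)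
  also have "\<dots> = (\<Sum>b<?M. \<Sum>a<?M. \<Sum>a'<?M. ?g b a a') * (\<Sum>b<?N. \<Sum>a<?N. \<Sum>a'<?N. ?h b a a')"
    by (intro sum3_mod_div_mult) auto
  also have "\<dots> = tens (d ^ m) (d ^ n) (platypus_compl d mu m \<rho>) (platypus_compl d mu n \<sigma>) $$ (e, e')"
    using e d by (simp add: tens_def platypus_compl_def div_less_mult)
  finally show "platypus_compl d mu (m + n) (tens ?M ?N \<rho> \<sigma>) $$ (e, e')
      = tens (d ^ m) (d ^ n) (platypus_compl d mu m \<rho>) (platypus_compl d mu n \<sigma>) $$ (e, e')" .
qed (simp_all add: platypus_compl_def tens_def power_add)

subsection \<open>Superadditivity and the regularized limit\<close>

text \<open>Fekete: for fixed \<open>m\<close>, writing \<open>n = q * m + r\<close> with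
  \<open>r < m\<close> gives \<open>a n / n\<close> at least \<open>a m / m\<close> up to an error
  of order \<open>1 / n\<close>. The linear bound keeps the supremum finite.\<close>

lemma superadditive_convergent:
  fixes a :: "nat \<Rightarrow> real"
  assumes super: "\<And>m n. a m + a n \<le> a (m + n)"
    and bound: "\<And>n. a n \<le> real n * C"
  shows "convergent (\<lambda>n. a n / real n)"
proof -
  define S where "S = (SUP n\<in>{1..}. a n / real n)"
  have le_C: "a n / real n \<le> C" if "n \<ge> 1" for n
    using bound[of n] that by (simp add: divide_le_eq mult.commute)
  have bdd: "bdd_above ((\<lambda>n. a n / real n) ` {1..})"
    using le_C by (intro bdd_aboveI2[where M = C]) auto
  have iter: "real q * a m + a r \<le> a (q * m + r)" for q m r
  proof (induction q)
    case (Suc q)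
    then show ?case using super[of m "q * m + r"] by (simp add: algebra_simps)
  qed simp
  have "(\<lambda>n. a n / real n) \<longlonglongrightarrow> S"
  proof (rule order_tendstoI)
    fix y assume "y < S"
    then obtain m where m: "m \<ge> 1" "y < a m / real m"
      unfolding S_def using bdd by (subst (asm) less_cSUP_iff) auto
    \<comment> \<open>Bounds the contribution of the remainder \<open>r = n mod m\<close> uniformly
      in \<open>n\<close>, since only \<open>m\<close> remainders occur.\<close>
    define K where "K = (\<Sum>r<m. \<bar>real r * (a m / real m) - a r\<bar>)"
    have lower: "a m / real m - K / real n \<le> a n / real n" if n: "n \<ge> 1" for n
    proof -
      define q r where "q = n div m" and "r = n mod m"
      have n_eq: "n = q * m + r" and r: "r < m" using m by (auto simp: q_def r_def)
      have "\<bar>real r * (a m / real m) - a r\<bar> \<le> K"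
        unfolding K_def using r by (intro member_le_sum) auto
      then have "real n * (a m / real m) - K \<le> real n * (a m / real m) - (real r * (a m / real m) - a r)"
        by linarith
      also have "\<dots> = real q * a m + a r"
        using m by (simp add: n_eq field_simps)
      also have "\<dots> \<le> a n" unfolding n_eq by (rule iter)
      finally have "(real n * (a m / real m) - K) / real n \<le> a n / real n"
        by (rule divide_right_mono) simp
      then show ?thesis using n by (simp add: diff_divide_distrib)
    qed
    have "(\<lambda>n. a m / real m - K / real n) \<longlonglongrightarrow> a m / real m - 0"
      by (intro tendsto_diff tendsto_const lim_const_over_n)
    then have "\<forall>\<^sub>F n in sequentially. y < a m / real m - K / real n"
      using m by (intro order_tendstoD(1)[where y = "a m / real m"]) auto
    then show "\<forall>\<^sub>F n in sequentially. y < a n / real n"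
      using eventually_ge_at_top[of 1]
      by eventually_elim (use lower in force)
  next
    fix y assume y: "S < y"
    show "\<forall>\<^sub>F n in sequentially. a n / real n < y"
      using eventually_ge_at_top[of 1]
    proof eventually_elim
      case (elim n)
      then have "a n / real n \<le> S" unfolding S_def by (intro cSUP_upper bdd) auto
      then show ?case using y by simp
    qed
  qed
  then show ?thesis by (auto simp: convergent_def)
qed

text \<open>Makes the suprema in \<open>platypus_Q1\<close> range over nonempty sets.\<close>

lemma density_op_exists:
  assumes "N > 0" shows "\<exists>\<rho>. density_op N \<rho>"
proof
  show "density_op N (mat N N (\<lambda>(i, j). of_bool (i = 0) * of_bool (j = 0)))"
    by (rule density_op_of_gram[where P = 1 and Q = 1 and G = "\<lambda>_ _ i. of_bool (i = 0)"])
      (use assms in \<open>auto simp: of_bool_def if_distrib cong: if_cong\<close>)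
qed

lemma platypus_density_op:
  assumes d: "d \<ge> 1" and mu: "\<forall>i<d. mu i \<ge> 0" "(\<Sum>i<d. mu i) = 1"
    and dens: "density_op ((d+1) ^ n) \<rho>"
  shows "density_op ((d+1) ^ n) (platypus_chan d mu n \<rho>)"
    and "density_op (d ^ n) (platypus_compl d mu n \<rho>)"
proof -
  let ?N = "(d+1) ^ n"
  obtain L where L: "\<And>i j. i < ?N \<Longrightarrow> j < ?N \<Longrightarrow> \<rho> $$ (i, j) = (\<Sum>l<?N. L i l * cnj (L j l))"
    and L1: "(\<Sum>l<?N. \<Sum>i<?N. (cmod (L i l))\<^sup>2) = 1"
    using density_op_gram[OF dens] by blast
  let ?T = "plat_T d mu n L"
  have chan: "platypus_chan d mu n \<rho> = mat ?N ?N (\<lambda>(b, b'). \<Sum>l<?N. \<Sum>e<d ^ n. ?T l b e * cnj (?T l b' e))"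
    and compl: "platypus_compl d mu n \<rho> = mat (d ^ n) (d ^ n) (\<lambda>(e, e'). \<Sum>l<?N. \<Sum>b<?N. ?T l b e * cnj (?T l b e'))"
    by (rule platypus_gram, rule L, assumption+)+
  have "complex_of_real (\<Sum>l<?N. \<Sum>b<?N. \<Sum>e<d ^ n. (cmod (?T l b e))\<^sup>2) = 1"
    unfolding plat_T_norm[OF d mu L1] by simp
  then have norm: "(\<Sum>l<?N. \<Sum>b<?N. \<Sum>e<d ^ n. ?T l b e * cnj (?T l b e)) = 1"
    by (simp add: complex_norm_square del: of_real_power)
  show "density_op ?N (platypus_chan d mu n \<rho>)"
  proof (rule density_op_of_gram[where G = "\<lambda>l e b. ?T l b e"])
    show "platypus_chan d mu n \<rho> \<in> carrier_mat ?N ?N" by (simp add: chan)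
    show "platypus_chan d mu n \<rho> $$ (i, j) = (\<Sum>l<?N. \<Sum>e<d ^ n. ?T l i e * cnj (?T l j e))"
      if "i < ?N" "j < ?N" for i j using that by (simp add: chan)
    have "(\<Sum>i<?N. platypus_chan d mu n \<rho> $$ (i, i)) = (\<Sum>i<?N. \<Sum>l<?N. \<Sum>e<d ^ n. ?T l i e * cnj (?T l i e))"
      by (simp add: chan)
    also have "\<dots> = 1" using norm by (subst sum.swap)
    finally show "(\<Sum>i<?N. platypus_chan d mu n \<rho> $$ (i, i)) = 1" .
  qed
  show "density_op (d ^ n) (platypus_compl d mu n \<rho>)"
  proof (rule density_op_of_gram[where G = ?T])
    show "platypus_compl d mu n \<rho> \<in> carrier_mat (d ^ n) (d ^ n)" by (simp add: compl)
    show "platypus_compl d mu n \<rho> $$ (i, j) = (\<Sum>l<?N. \<Sum>b<?N. ?T l b i * cnj (?T l b j))"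
      if "i < d ^ n" "j < d ^ n" for i j using that by (simp add: compl)
    have "(\<Sum>i<d ^ n. platypus_compl d mu n \<rho> $$ (i, i)) = (\<Sum>e<d ^ n. \<Sum>l<?N. \<Sum>b<?N. ?T l b e * cnj (?T l b e))"
      by (simp add: compl)
    also have "\<dots> = (\<Sum>l<?N. \<Sum>e<d ^ n. \<Sum>b<?N. ?T l b e * cnj (?T l b e))"
      by (rule sum.swap)
    also have "\<dots> = (\<Sum>l<?N. \<Sum>b<?N. \<Sum>e<d ^ n. ?T l b e * cnj (?T l b e))"
      by (rule sum.cong[OF refl], rule sum.swap)
    finally show "(\<Sum>i<d ^ n. platypus_compl d mu n \<rho> $$ (i, i)) = 1" using norm by simp
  qed
qed

theorem theorem1:
  fixes d :: nat and mu :: "nat \<Rightarrow> real"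
  assumes "d \<ge> 1"
    and "\<forall>i<d. mu i \<ge> 0"
    and "(\<Sum>i<d. mu i) = 1"
  shows "platypus_Q d mu \<le> log 2 (1 + sqrt (Max (mu ` {..<d})))"
proof -
  define t where "t = sqrt (Max (mu ` {..<d}))"
  define coh where "coh n \<rho> = vn_entropy (platypus_chan d mu n \<rho>) - vn_entropy (platypus_compl d mu n \<rho>)" for n \<rho>
  define R where "R n = {\<rho>. density_op ((d+1) ^ n) \<rho>}" for n
  have mu_le: "mu i \<le> Max (mu ` {..<d})" if "i < d" for i
    using that by (intro Max_ge) auto
  \<comment> \<open>A distribution with total mass 1 has a nonzero entry, so \<open>t\<close> is
    positive and the weights \<open>mu i / t\<close> make sense.\<close>
  obtain i where "i < d" "mu i \<noteq> 0"
    using assms(3) by (metis (mono_tags, lifting) lessThan_iff sum.neutral zero_neq_one)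
  then have "Max (mu ` {..<d}) > 0"
    using mu_le[of i] assms(2) by (metis less_eq_real_def order_less_le_trans)
  then have t: "t > 0" "\<forall>i<d. mu i \<le> t\<^sup>2"
    using mu_le by (auto simp: t_def)
  have coh_le: "coh n \<rho> \<le> real n * log 2 (1 + t)" if "\<rho> \<in> R n" for n \<rho>
    using platypus_coherent_le[OF assms t] that by (simp add: coh_def R_def)
  have bdd: "bdd_above (coh n ` R n)" for n
    using coh_le by (intro bdd_aboveI2) auto
  have ne: "R n \<noteq> {}" for n
    using density_op_exists[of "(d+1) ^ n"] by (auto simp: R_def)
  have Q1: "platypus_Q1 d mu n = (SUP \<rho>\<in>R n. coh n \<rho>)" for n
    by (simp add: platypus_Q1_def coh_def R_def)
  have Q1_le: "platypus_Q1 d mu n \<le> real n * log 2 (1 + t)" for n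
    unfolding Q1 by (intro cSUP_least ne coh_le)
  have "platypus_Q1 d mu m + platypus_Q1 d mu n \<le> platypus_Q1 d mu (m + n)" for m n
  proof -
    have step: "coh m \<rho> + coh n \<sigma> \<le> platypus_Q1 d mu (m + n)" if "\<rho> \<in> R m" "\<sigma> \<in> R n" for \<rho> \<sigma>
    proof -
      let ?\<tau> = "tens ((d+1) ^ m) ((d+1) ^ n) \<rho> \<sigma>"
      have dens: "density_op ((d+1) ^ m) \<rho>" "density_op ((d+1) ^ n) \<sigma>"
        using that by (auto simp: R_def)
      have "coh (m + n) ?\<tau> = coh m \<rho> + coh n \<sigma>"
        unfolding coh_def platypus_chan_tens[OF assms(1)] platypus_compl_tens[OF assms(1)]
        using assms(1) platypus_density_op[OF assms dens(1)] platypus_density_op[OF assms dens(2)]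
        by (simp add: vn_entropy_tens)
      moreover have "?\<tau> \<in> R (m + n)"
        using density_op_tens[OF _ dens] by (simp add: R_def power_add)
      ultimately show ?thesis
        unfolding Q1 using cSUP_upper[OF _ bdd] by metis
    qed
    \<comment> \<open>The two suprema are taken in turn: over the second input with the first one
      fixed, then over the first.\<close>
    have "platypus_Q1 d mu n \<le> platypus_Q1 d mu (m + n) - coh m \<rho>" if "\<rho> \<in> R m" for \<rho>
      unfolding Q1[of n] using step[OF that] by (intro cSUP_least ne) (simp add: algebra_simps)
    then have "platypus_Q1 d mu m \<le> platypus_Q1 d mu (m + n) - platypus_Q1 d mu n"
      unfolding Q1[of m] by (intro cSUP_least ne) (simp add: algebra_simps)
    then show ?thesis by simp
  qed
  then have "convergent (\<lambda>n. platypus_Q1 d mu n / real n)"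
    using Q1_le by (rule superadditive_convergent)
  then have "(\<lambda>n. platypus_Q1 d mu n / real n) \<longlonglongrightarrow> platypus_Q d mu"
    by (simp add: convergent_LIMSEQ_iff platypus_Q_def)
  then have "platypus_Q d mu \<le> log 2 (1 + t)"
  proof (rule tendsto_upperbound)
    show "\<forall>\<^sub>F n in sequentially. platypus_Q1 d mu n / real n \<le> log 2 (1 + t)"
      using eventually_ge_at_top[of 1]
    proof eventually_elim
      case (elim n)
      then show ?case using Q1_le[of n] by (simp add: divide_le_eq mult.commute)
    qed
  qed simp
  then show ?thesis by (simp add: t_def)
qed

end
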